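(* Let $X$ be a Banach space (real or complex), $U\subset X$ an open set, and $f:U\to X$ a continuously differentiable map. Suppose that $K\subset U$ is a compact set with $f(K)\supseteq K$, and assume that for some $\lambda$ with $0<\lambda<\frac12$, $$Df(x)\in \mathscr{L}_{\lambda/2}(X)\qquad\text{for all } x\in K.$$ Then $n=\sup_{x\in K}\nu_\lambda(Df(x))$ and $D=\sup_{x\in K}\|Df(x)\|$ are finite, and $$N_X(Df(x)[B_X(0,1)],2\lambda)\le \left[(n+1)\frac{D}{\lambda}\right]^{\alpha n}\qquad\text{for all } x\in K,$$ where $\alpha=1$ if $X$ is real and $\alpha=2$ if $X$ is complex. It follows that $$\dim_B(K)\le \alpha n\,\frac{\log((n+1)D/\lambda)}{-\log(2\lambda)}.$$ (When $n=0$, the right-hand side of the covering bound is read as $1$ and the right-hand side of the dimension bound as $0$.)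
   Context: $B_X(x,r)$ denotes the ball in $X$ of radius $r$ centred at $x$, and $Df(x)$ is the (Fréchet) derivative. For $S\subset X$ and $\epsilon>0$, $N_X(S,\epsilon)$ is the minimum number of balls in $X$ of radius $\epsilon$ needed to cover $S$. The upper box-counting dimension of a compact set $K\subset X$ is $\dim_B(K)=\limsup_{\epsilon\to0}\frac{\log N_X(K,\epsilon)}{-\log\epsilon}$. $\mathscr{L}(X)$ is the space of bounded linear maps from $X$ to itself, with operator norm, and $\mathcal{K}(X)$ is the subspace of compact linear maps. For $\mu>0$, $$\mathscr{L}_\mu(X)=\{T\in\mathscr{L}(X): T=L+C \text{ with } C\in\mathcal{K}(X) \text{ and } \|L\|_{\mathscr{L}(X)}<\mu\}.$$ For subsets $A,B$ of $X$, $\operatorname{dist}(A,B)=\sup_{a\in A}\inf_{b\in B}\|a-b\|_X$ (Hausdorff semi-distance). For $T\in\mathscr{L}_{\lambda/2}(X)$, $\nu_\lambda(T)$ denotes the minimum integer $n\ge 0$ such that there is an $n$-dimensional linear subspace $Z$ of $X$ with $$\operatorname{dist}(T[B_X(0,1)],T[B_Z(0,1)])<\lambda,$$ where $B_Z(0,1)$ is the unit ball of $Z$ with the norm of $X$ (such an $n$ always exists for $T\in\mathscr{L}_{\lambda/2}(X)$). Dimensions of subspaces are taken over the scalar field of $X$. *)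

theory Defs
  imports "HOL-Analysis.Analysis"
begin

text \<open>
  A real Banach space is a type of class \<open>banach\<close> with scalar multiplication \<open>scaleR\<close>.  The libraries
  have no class of complex normed spaces, so a complex Banach space is a type of class \<open>banach\<close>
  together with a scalar multiplication by complex numbers that extends \<open>scaleR\<close> and for which the
  norm is homogeneous.  Every notion below that depends on the scalar field takes the scalar
  multiplication as its first argument.
\<close>

locale normed_space_over = vector_space sc
  for sc :: "'k::real_normed_field \<Rightarrow> 'a::real_normed_vector \<Rightarrow> 'a" +
  assumes norm_scale: "norm (sc c x) = norm c * norm x"
    and scale_of_real: "sc (of_real r) x = r *\<^sub>R x"

lemma normed_space_over_scaleR:
  "normed_space_over (scaleR :: real \<Rightarrow> 'a::real_normed_vector \<Rightarrow> 'a)"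
  by unfold_locales (auto simp: algebra_simps)

lemma normed_space_over_complex:
  "normed_space_over ((*) :: complex \<Rightarrow> complex \<Rightarrow> complex)"
  by unfold_locales (auto simp: algebra_simps norm_mult scaleR_conv_of_real)

text \<open>
  The type \<open>'a \<Rightarrow>\<^sub>L 'a\<close> consists of real-linear maps, so linearity over the actual scalar field is
  demanded separately; it is automatic for \<open>sc = scaleR\<close>.
\<close>

definition bounded_maps ::
  "('k::real_normed_field \<Rightarrow> 'a::real_normed_vector \<Rightarrow> 'a) \<Rightarrow> ('a \<Rightarrow>\<^sub>L 'a) set"
  where "bounded_maps sc = {T. Vector_Spaces.linear sc sc (blinfun_apply T)}"

definition compact_maps ::
  "('k::real_normed_field \<Rightarrow> 'a::real_normed_vector \<Rightarrow> 'a) \<Rightarrow> ('a \<Rightarrow>\<^sub>L 'a) set"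
  where "compact_maps sc =
    {T \<in> bounded_maps sc. \<forall>S. bounded S \<longrightarrow> compact (closure (blinfun_apply T ` S))}"

definition near_compact_maps ::
  "('k::real_normed_field \<Rightarrow> 'a::real_normed_vector \<Rightarrow> 'a) \<Rightarrow> real \<Rightarrow> ('a \<Rightarrow>\<^sub>L 'a) set"
  where "near_compact_maps sc \<mu> =
    {T \<in> bounded_maps sc. \<exists>L C. L \<in> bounded_maps sc \<and> C \<in> compact_maps sc \<and> T = L + C \<and> norm L < \<mu>}"

definition hausdorff_semidist :: "'a::real_normed_vector set \<Rightarrow> 'a set \<Rightarrow> ereal"
  where "hausdorff_semidist A B = (SUP a\<in>A. INF b\<in>B. ereal (norm (a - b)))"

text \<open>
  Stated with a finite basis because \<open>vector_space.dim\<close> is \<open>0\<close> on infinite-dimensional subspaces.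
\<close>

definition subspace_of_dim ::
  "('k::real_normed_field \<Rightarrow> 'a::real_normed_vector \<Rightarrow> 'a) \<Rightarrow> nat \<Rightarrow> 'a set \<Rightarrow> bool"
  where "subspace_of_dim sc n Z \<longleftrightarrow>
    module.subspace sc Z \<and>
    (\<exists>B. finite B \<and> card B = n \<and> \<not> module.dependent sc B \<and> module.span sc B = Z)"

text \<open>
  The value is \<open>\<infinity>\<close> if no finite-dimensional subspace qualifies, which does not happen for
  \<open>T \<in> near_compact_maps sc (lam/2)\<close>.
\<close>

definition nu :: "('k::real_normed_field \<Rightarrow> 'a::real_normed_vector \<Rightarrow> 'a) \<Rightarrow> real \<Rightarrow> ('a \<Rightarrow>\<^sub>L 'a) \<Rightarrow> enat"
  where "nu sc lam T = Inf {enat n | n. \<exists>Z. subspace_of_dim sc n Z \<and>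
    hausdorff_semidist (blinfun_apply T ` ball 0 1) (blinfun_apply T ` (ball 0 1 \<inter> Z)) < ereal lam}"

text \<open>The value is \<open>\<infinity>\<close> if no finite family of balls covers \<open>S\<close>.\<close>

definition covering_number :: "'a::metric_space set \<Rightarrow> real \<Rightarrow> enat"
  where "covering_number S \<epsilon> = Inf {enat (card C) | C. finite C \<and> S \<subseteq> (\<Union>c\<in>C. ball c \<epsilon>)}"

text \<open>Since \<open>ln 0 = 0\<close>, the empty set gets dimension \<open>0\<close>.\<close>

definition upper_box_dim :: "'a::metric_space set \<Rightarrow> ereal"
  where "upper_box_dim K = Limsup (at_right 0)
    (\<lambda>\<epsilon>. case covering_number K \<epsilon> of enat N \<Rightarrow> ereal (ln (real N) / - ln \<epsilon>) | \<infinity> \<Rightarrow> \<infinity>)"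

end

(*
  Covering T[B(0,1)]: it lies within lam of T[B_Z(0,1)], so it suffices to cover a ball of radius D
  in a space of real dimension N by balls of radius lam.  A maximal lam-separated subset does this, and
  lam-separated sets in that ball have at most (1 + 2 D / lam)^N elements.  The latter is usually read off
  by comparing volumes; here a separated set A is instead iterated: with q = 1 + 2 D / lam, the set
  A + q A + ... + q^(j-1) A is again separated, has card A ^ j elements and lies in a ball of radius
  proportional to q^j, while norm equivalence alone bounds its size by const * q^(j N).  Since D >= lam, the bound is
  at most (3 D / lam)^N, which suffices when n >= 2; for n = 1 a disc in the scalar field is cut into
  rectangles.

  Dimension: near K the map f is uniformly close to its linearization, so a cover of K by balls of radius r
  (with centres near K, not necessarily in K) is mapped to one with M times as many balls of radius
  theta r, for any theta > 2 lam.  Since K is contained in f(K), iterating gives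
  dim K <= log M / - log theta, and theta tends to 2 lam.
*)

theory Submission
  imports Defs
begin

section \<open>Separated sets in finite-dimensional normed spaces\<close>

text \<open>Induction on the basis. The new vector \<open>v\<close> has positive distance
  \<open>d\<close> from \<open>span B\<close>: otherwise combinations of \<open>B\<close> converge
  to \<open>v\<close>, the induction hypothesis makes their coefficients Cauchy, and the limits put
  \<open>v\<close> into \<open>span B\<close>. This distance controls the coefficient of
  \<open>v\<close>; the others follow after subtracting the \<open>v\<close> part.\<close>

lemma independent_coeff_bound:
  fixes B :: "'a::real_normed_vector set"
  assumes "finite B" "independent B"
  shows "\<exists>c>0. \<forall>u. \<forall>b\<in>B. \<bar>u b\<bar> \<le> c * norm (\<Sum>b\<in>B. u b *\<^sub>R b)"
  using assms
proof (induction B rule: finite_induct)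
  case empty
  then show ?case by (auto intro: exI[of _ 1])
next
  case (insert v B)
  have "independent B" and v: "v \<notin> span B"
    using insert.prems insert.hyps by (simp_all add: independent_insert)
  then obtain c where "c > 0" and c: "\<And>u b. b \<in> B \<Longrightarrow> \<bar>u b\<bar> \<le> c * norm (\<Sum>b\<in>B. u b *\<^sub>R b)"
    using insert.IH by blast
  have span_B: "span B = range (\<lambda>u. \<Sum>b\<in>B. u b *\<^sub>R b)"
    using span_finite[OF insert.hyps(1)] by simp
  have "\<exists>d>0. \<forall>z\<in>span B. d \<le> norm (v - z)"
  proof (rule ccontr)
    assume "\<not> ?thesis"
    then have "\<exists>z\<in>span B. norm (v - z) < inverse (real (Suc k))" for k
      by (metis not_less inverse_positive_iff_positive of_nat_0_less_iff zero_less_Suc)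
    then have "\<exists>u. norm (v - (\<Sum>b\<in>B. u b *\<^sub>R b)) < inverse (real (Suc k))" for k
      unfolding span_B by blast
    then obtain u where u: "\<And>k. norm (v - (\<Sum>b\<in>B. u k b *\<^sub>R b)) < inverse (real (Suc k))"
      by metis
    define s where "s k = (\<Sum>b\<in>B. u k b *\<^sub>R b)" for k
    have "(\<lambda>k. v - s k) \<longlonglongrightarrow> 0"
      using u by (intro LIMSEQ_norm_0) (simp add: s_def inverse_eq_divide)
    from tendsto_diff[OF tendsto_const[of v] this] have s: "s \<longlonglongrightarrow> v"
      by simp
    have "convergent (\<lambda>k. u k b)" if "b \<in> B" for b
    proof -
      have "Cauchy (\<lambda>k. u k b)"
      proof (rule metric_CauchyI)
        fix e :: real assume "e > 0"
        then have "e / c > 0" using \<open>c > 0\<close> by simp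
        then obtain M where M: "\<forall>m\<ge>M. \<forall>n\<ge>M. dist (s m) (s n) < e / c"
          using metric_CauchyD[OF LIMSEQ_imp_Cauchy[OF s]] by blast
        have "dist (u m b) (u n b) < e" if "m \<ge> M" "n \<ge> M" for m n
        proof -
          have "dist (u m b) (u n b) \<le> c * dist (s m) (s n)"
            using c[OF \<open>b \<in> B\<close>, of "\<lambda>b. u m b - u n b"]
            by (simp add: dist_norm s_def scaleR_left_diff_distrib sum_subtractf)
          also have "\<dots> < e"
            using M that \<open>c > 0\<close> by (simp add: field_simps)
          finally show ?thesis .
        qed
        then show "\<exists>M. \<forall>m\<ge>M. \<forall>n\<ge>M. dist (u m b) (u n b) < e" by blast
      qed
      then show ?thesis by (simp add: Cauchy_convergent_iff)
    qed
    then have "s \<longlonglongrightarrow> (\<Sum>b\<in>B. lim (\<lambda>k. u k b) *\<^sub>R b)"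
      unfolding s_def by (intro tendsto_intros) (simp add: convergent_LIMSEQ_iff)
    then have "v = (\<Sum>b\<in>B. lim (\<lambda>k. u k b) *\<^sub>R b)"
      using s LIMSEQ_unique by blast
    then show False
      using v span_B by (metis rangeI)
  qed
  then obtain d where "d > 0" and d: "\<And>z. z \<in> span B \<Longrightarrow> d \<le> norm (v - z)" by blast
  \<comment> \<open>The first entry serves the coefficient of \<open>v\<close>, the second those of
    \<open>B\<close>, where \<open>norm z \<le> (1 + norm v / d) * norm y\<close>.\<close>
  define c' where "c' = max (inverse d) (c * (1 + norm v / d))"
  have "c' > 0" using \<open>d > 0\<close> by (simp add: c'_def less_max_iff_disj)
  moreover have "\<bar>u b\<bar> \<le> c' * norm (\<Sum>b\<in>insert v B. u b *\<^sub>R b)" if "b \<in> insert v B" for u b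
  proof -
    define y where "y = (\<Sum>b\<in>insert v B. u b *\<^sub>R b)"
    define z where "z = (\<Sum>b\<in>B. u b *\<^sub>R b)"
    have y: "y = u v *\<^sub>R v + z"
      using insert.hyps by (simp add: y_def z_def)
    have "z \<in> span B" by (simp add: z_def span_B)
    have uv: "\<bar>u v\<bar> \<le> norm y / d"
    proof (cases "u v = 0")
      case False
      have "d \<le> norm (v - (- inverse (u v)) *\<^sub>R z)"
        by (rule d) (use \<open>z \<in> span B\<close> in \<open>auto intro: span_scale span_neg\<close>)
      also have "v - (- inverse (u v)) *\<^sub>R z = inverse (u v) *\<^sub>R y"
        using False by (simp add: y algebra_simps)
      finally show ?thesis
        using False \<open>d > 0\<close> by (simp add: field_simps)
    qed (use \<open>d > 0\<close> in auto)
    show ?thesis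
    proof (cases "b = v")
      case True
      have "norm y / d \<le> c' * norm y"
        unfolding divide_inverse mult.commute[of "norm y"] by (intro mult_right_mono) (simp_all add: c'_def)
      then show ?thesis using uv True y_def by simp
    next
      case False
      then have "\<bar>u b\<bar> \<le> c * norm z" using c that by (simp add: z_def)
      also have "norm z \<le> norm y + \<bar>u v\<bar> * norm v"
        using norm_triangle_ineq4[of y "u v *\<^sub>R v"] by (simp add: y)
      also have "\<dots> \<le> norm y + norm y / d * norm v"
        by (intro add_left_mono mult_right_mono uv) auto
      also have "\<dots> = (1 + norm v / d) * norm y" by (simp add: algebra_simps)
      also have "c * \<dots> \<le> c' * norm y"
        unfolding mult.assoc[symmetric] by (intro mult_right_mono) (auto simp: c'_def)
      finally show ?thesis
        using \<open>c > 0\<close> by (simp add: y_def)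
    qed
  qed
  ultimately show ?case by blast
qed

text \<open>Coordinates are rounded to a grid so fine that two points of one cell are closer than
  \<open>\<delta>\<close>, and the cells are counted. The constant \<open>C\<close> is crude but
  chosen before \<open>Q\<close>; this uniformity lets it disappear in
  \<open>separated_card_le\<close>.\<close>

lemma separated_card_crude:
  fixes E :: "'a::real_normed_vector set" and \<delta> r :: real
  assumes "finite E" "\<delta> > 0" "r \<ge> 0"
  shows "\<exists>C\<ge>0. \<forall>Q\<ge>1. \<forall>A. finite A \<longrightarrow> A \<subseteq> span E \<longrightarrow> A \<subseteq> cball 0 (r * Q) \<longrightarrow>
    (\<forall>x\<in>A. \<forall>y\<in>A. x \<noteq> y \<longrightarrow> \<delta> \<le> dist x y) \<longrightarrow> real (card A) \<le> (C * Q) ^ card E"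
proof -
  obtain B where B: "B \<subseteq> E" "independent B" "E \<subseteq> span B"
    using maximal_independent_subset[of E] by blast
  then have "finite B" "card B \<le> card E" and span_B: "span E \<subseteq> span B"
    using assms finite_subset card_mono span_minimal[of E "span B"] by auto
  obtain c where "c > 0" and c: "\<And>u b. b \<in> B \<Longrightarrow> \<bar>u b\<bar> \<le> c * norm (\<Sum>b\<in>B. u b *\<^sub>R b)"
    using independent_coeff_bound[OF \<open>finite B\<close> B(2)] by blast
  \<comment> \<open>\<open>1 / s\<close> is the mesh of the grid. The summand 1 makes the comparison
    with \<open>\<delta>\<close> strict and keeps \<open>s\<close> positive when \<open>B\<close> is
    empty.\<close>
  define s where "s = (1 + (\<Sum>b\<in>B. norm b)) / \<delta>"
  have "s > 0" using assms by (simp add: s_def sum_nonneg add_pos_nonneg)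
  \<comment> \<open>Each coordinate takes \<open>2 * m + 1\<close> values, at most
    \<open>2 * (c * (r * Q) * s) + 3\<close>; since \<open>Q \<ge> 1\<close>, the 3 is absorbed into
    \<open>C * Q\<close>.\<close>
  define C where "C = 2 * (c * r * s) + 3"
  have "C \<ge> 1" using \<open>c > 0\<close> \<open>s > 0\<close> assms by (simp add: C_def)
  have "real (card A) \<le> (C * Q) ^ card E"
    if "Q \<ge> 1" "A \<subseteq> span E" "A \<subseteq> cball 0 (r * Q)"
      and sep: "\<And>x y. x \<in> A \<Longrightarrow> y \<in> A \<Longrightarrow> x \<noteq> y \<Longrightarrow> \<delta> \<le> dist x y" for Q A
  proof -
    have "\<forall>x\<in>A. \<exists>u. x = (\<Sum>b\<in>B. u b *\<^sub>R b)"
      using that(2) span_B span_finite[OF \<open>finite B\<close>] by blast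
    then obtain u where u: "\<And>x. x \<in> A \<Longrightarrow> x = (\<Sum>b\<in>B. u x b *\<^sub>R b)"
      by metis
    define m where "m = \<lceil>c * (r * Q) * s\<rceil>"
    have "0 \<le> c * (r * Q) * s" using \<open>c > 0\<close> \<open>s > 0\<close> assms that(1) by simp
    then have "m \<ge> 0" unfolding m_def by linarith
    \<comment> \<open>Restriction to \<open>B\<close> makes \<open>\<phi> x\<close> extensional, so
      the values lie in a finite product set.\<close>
    define \<phi> where "\<phi> x = (\<lambda>b\<in>B. \<lfloor>u x b * s\<rfloor>)" for x
    have "inj_on \<phi> A"
    proof (rule inj_onI, rule ccontr)
      fix x y assume xy: "x \<in> A" "y \<in> A" "\<phi> x = \<phi> y" "x \<noteq> y"
      have "\<bar>u x b - u y b\<bar> \<le> 1 / s" if "b \<in> B" for b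
      proof -
        have "\<lfloor>u x b * s\<rfloor> = \<lfloor>u y b * s\<rfloor>"
          using fun_cong[OF xy(3), of b] that by (simp add: \<phi>_def)
        then have "\<bar>u x b * s - u y b * s\<bar> \<le> 1" by linarith
        then have "\<bar>u x b - u y b\<bar> * s \<le> 1"
          using \<open>s > 0\<close> by (metis abs_mult abs_of_pos left_diff_distrib)
        then show ?thesis using \<open>s > 0\<close> by (simp add: field_simps)
      qed
      note close = this
      have "x - y = (\<Sum>b\<in>B. u x b *\<^sub>R b) - (\<Sum>b\<in>B. u y b *\<^sub>R b)"
        using u[OF xy(1)] u[OF xy(2)] by simp
      then have "x - y = (\<Sum>b\<in>B. (u x b - u y b) *\<^sub>R b)"
        by (simp add: scaleR_left_diff_distrib sum_subtractf)
      then have "dist x y \<le> (\<Sum>b\<in>B. \<bar>u x b - u y b\<bar> * norm b)"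
        by (simp add: dist_norm) (metis (no_types, lifting) norm_scaleR norm_sum sum.cong)
      also have "\<dots> \<le> (\<Sum>b\<in>B. 1 / s * norm b)"
        by (intro sum_mono mult_right_mono close) auto
      also have "\<dots> = (\<Sum>b\<in>B. norm b) / s" by (simp add: sum_divide_distrib)
      also have "\<dots> < \<delta>"
      proof -
        have "(\<Sum>b\<in>B. norm b) < \<delta> * s" using assms by (simp add: s_def)
        then show ?thesis using \<open>s > 0\<close> by (simp add: field_simps)
      qed
      finally show False using sep[OF xy(1,2,4)] by simp
    qed
    moreover have "\<phi> ` A \<subseteq> (\<Pi>\<^sub>E b\<in>B. {-m..m})"
    proof (intro image_subsetI)
      fix x assume "x \<in> A"
      have "\<lfloor>u x b * s\<rfloor> \<in> {-m..m}" if "b \<in> B" for b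
      proof -
        have "\<bar>u x b\<bar> \<le> c * norm x"
          using c[OF that, of "u x"] u[OF \<open>x \<in> A\<close>] by simp
        also have "\<dots> \<le> c * (r * Q)"
          using \<open>x \<in> A\<close> that(1) \<open>A \<subseteq> cball 0 (r * Q)\<close> \<open>c > 0\<close> by (intro mult_left_mono) auto
        finally have "\<bar>u x b\<bar> * s \<le> c * (r * Q) * s"
          using \<open>s > 0\<close> by (simp add: mult_right_mono)
        then have "\<bar>u x b * s\<bar> \<le> c * (r * Q) * s"
          using \<open>s > 0\<close> by (simp add: abs_mult)
        then have "- of_int m \<le> u x b * s" "u x b * s \<le> of_int m"
          unfolding m_def by linarith+
        then show ?thesis
          by (simp add: le_floor_iff floor_le_iff)
      qed
      then show "\<phi> x \<in> (\<Pi>\<^sub>E b\<in>B. {-m..m})" by (auto simp: \<phi>_def)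
    qed
    ultimately have "card A \<le> card (\<Pi>\<^sub>E b\<in>B. {-m..m})"
      using \<open>finite B\<close> by (intro card_inj_on_le) (auto intro: finite_PiE)
    also have "\<dots> = nat (2 * m + 1) ^ card B"
      using \<open>finite B\<close> \<open>m \<ge> 0\<close> by (simp add: card_PiE algebra_simps)
    finally have "real (card A) \<le> real (nat (2 * m + 1)) ^ card B"
      by (metis of_nat_le_iff of_nat_power)
    also have "\<dots> \<le> (C * Q) ^ card B"
    proof (rule power_mono)
      have "of_int m \<le> c * (r * Q) * s + 1" unfolding m_def by linarith
      then have "real (nat (2 * m + 1)) \<le> 2 * (c * (r * Q) * s) + 3"
        using \<open>m \<ge> 0\<close> by simp
      also have "\<dots> \<le> C * Q"
        using \<open>Q \<ge> 1\<close> by (simp add: C_def algebra_simps)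
      finally show "real (nat (2 * m + 1)) \<le> C * Q" .
    qed simp
    also have "\<dots> \<le> (C * Q) ^ card E"
      by (rule power_increasing)
        (use \<open>card B \<le> card E\<close> \<open>C \<ge> 1\<close> \<open>Q \<ge> 1\<close> mult_mono[of 1 C 1 Q] in auto)
    finally show ?thesis .
  qed
  then show ?thesis
    using \<open>C \<ge> 1\<close> by (intro exI[of _ C]) auto
qed

text \<open>The points of \<open>A\<close> act as digits in base \<open>q\<close>. The choice
  \<open>D = \<delta> / 2 * (q - 1)\<close> makes expansions of length \<open>j\<close> pairwise
  distinct and again \<open>\<delta>\<close>-separated. The crude bound, applied to all of them,
  then has a constant that is negligible against \<open>j\<close>-th powers.\<close>

lemma separated_card_le:
  fixes E A :: "'a::real_normed_vector set"
  assumes "finite E" "finite A" "A \<subseteq> span E" "A \<subseteq> cball 0 D" "\<delta> > 0" "D \<ge> 0"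
    and sep: "\<And>x y. x \<in> A \<Longrightarrow> y \<in> A \<Longrightarrow> x \<noteq> y \<Longrightarrow> \<delta> \<le> dist x y"
  shows "real (card A) \<le> (1 + 2 * D / \<delta>) ^ card E"
proof -
  define q where "q = 1 + 2 * D / \<delta>"
  have "q \<ge> 1" using assms by (simp add: q_def)
  have D: "D = \<delta> / 2 * (q - 1)" using assms by (simp add: q_def)
  \<comment> \<open>The radius is the geometric sum of the digit radii. Its \<open>- 1\<close>
    preserves the separation: different leading digits give a distance of at least \<open>q ^ j *
    \<delta> - 2 * (\<delta> / 2 * (q ^ j - 1)) = \<delta>\<close>.\<close>
  have iter: "\<exists>S. finite S \<and> card S = card A ^ j \<and> S \<subseteq> span E \<and> S \<subseteq> cball 0 (\<delta> / 2 * (q ^ j - 1)) \<and>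
      (\<forall>x\<in>S. \<forall>y\<in>S. x \<noteq> y \<longrightarrow> \<delta> \<le> dist x y)" for j
  proof (induction j)
    case 0
    then show ?case by (intro exI[of _ "{0}"]) (auto simp: span_zero)
  next
    case (Suc j)
    then obtain S where S: "finite S" "card S = card A ^ j" "S \<subseteq> span E"
        "S \<subseteq> cball 0 (\<delta> / 2 * (q ^ j - 1))"
      and S_sep: "\<forall>x\<in>S. \<forall>y\<in>S. x \<noteq> y \<longrightarrow> \<delta> \<le> dist x y"
      by (elim exE conjE)
    define g where "g = (\<lambda>(x, s :: 'a). q ^ j *\<^sub>R x + s)"
    have far: "\<delta> \<le> dist (g (x, s)) (g (y, t))"
      if "x \<in> A" "s \<in> S" "y \<in> A" "t \<in> S" "(x, s) \<noteq> (y, t)" for x y s t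
    proof (cases "x = y")
      case True
      then show ?thesis using that S_sep by (simp add: g_def dist_norm)
    next
      case False
      have "q ^ j * \<delta> \<le> norm (q ^ j *\<^sub>R (x - y))"
        using sep[OF that(1,3) False] \<open>q \<ge> 1\<close> by (simp add: dist_norm)
      also have "\<dots> = norm ((g (x, s) - g (y, t)) + (t - s))"
        by (simp add: g_def algebra_simps)
      also have "\<dots> \<le> dist (g (x, s)) (g (y, t)) + norm (t - s)"
        using norm_triangle_ineq by (simp add: dist_norm)
      also have "norm (t - s) \<le> norm t + norm s" by (rule norm_triangle_ineq4)
      also have "norm t + norm s \<le> \<delta> * (q ^ j - 1)"
      proof -
        have "norm s \<le> \<delta> / 2 * (q ^ j - 1)" "norm t \<le> \<delta> / 2 * (q ^ j - 1)"
          using S(4) that by (meson mem_cball_0 subsetD)+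
        then show ?thesis by simp
      qed
      finally show ?thesis by (simp add: algebra_simps)
    qed
    have inj: "inj_on g (A \<times> S)"
    proof (rule inj_onI, rule ccontr)
      fix p p' assume *: "p \<in> A \<times> S" "p' \<in> A \<times> S" "g p = g p'" "p \<noteq> p'"
      then have "\<delta> \<le> dist (g p) (g p')"
        using far[of "fst p" "snd p" "fst p'" "snd p'"] by (simp add: mem_Times_iff)
      then show False using * \<open>\<delta> > 0\<close> by simp
    qed
    show ?case
    proof (intro exI[of _ "g ` (A \<times> S)"] conjI)
      show "finite (g ` (A \<times> S))" using S assms by simp
      show "card (g ` (A \<times> S)) = card A ^ Suc j"
        using inj S by (simp add: card_image card_cartesian_product)
      show "g ` (A \<times> S) \<subseteq> span E"
        using S assms by (auto simp: g_def intro!: span_add span_scale)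
      have "norm (q ^ j *\<^sub>R x + s) \<le> \<delta> / 2 * (q ^ Suc j - 1)" if "x \<in> A" "s \<in> S" for x s
      proof -
        have "norm (q ^ j *\<^sub>R x + s) \<le> q ^ j * norm x + norm s"
          using norm_triangle_ineq[of "q ^ j *\<^sub>R x" s] \<open>q \<ge> 1\<close> by simp
        also have "\<dots> \<le> q ^ j * (\<delta> / 2 * (q - 1)) + \<delta> / 2 * (q ^ j - 1)"
          using that assms(4) S(4) \<open>q \<ge> 1\<close> D by (intro add_mono mult_left_mono) auto
        also have "\<dots> = \<delta> / 2 * (q ^ Suc j - 1)" by (simp add: field_simps)
        finally show ?thesis .
      qed
      then show "g ` (A \<times> S) \<subseteq> cball 0 (\<delta> / 2 * (q ^ Suc j - 1))" by (auto simp: g_def)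
      show "\<forall>x\<in>g ` (A \<times> S). \<forall>y\<in>g ` (A \<times> S). x \<noteq> y \<longrightarrow> \<delta> \<le> dist x y"
        using far by blast
    qed
  qed
  have "\<delta> / 2 \<ge> 0" using assms by simp
  from separated_card_crude[OF assms(1,5) this]
  obtain C where "C \<ge> 0"
    and C: "\<forall>Q\<ge>1. \<forall>S. finite S \<longrightarrow> S \<subseteq> span E \<longrightarrow> S \<subseteq> cball 0 (\<delta> / 2 * Q) \<longrightarrow>
      (\<forall>x\<in>S. \<forall>y\<in>S. x \<noteq> y \<longrightarrow> \<delta> \<le> dist x y) \<longrightarrow> real (card S) \<le> (C * Q) ^ card E"
    by (elim exE conjE)
  have bound: "(real (card A) / q ^ card E) ^ j \<le> C ^ card E" for j
  proof -
    obtain S where S: "finite S" "card S = card A ^ j" "S \<subseteq> span E"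
        "S \<subseteq> cball 0 (\<delta> / 2 * (q ^ j - 1))" "\<forall>x\<in>S. \<forall>y\<in>S. x \<noteq> y \<longrightarrow> \<delta> \<le> dist x y"
      using iter[of j] by (elim exE conjE)
    have "\<delta> / 2 * (q ^ j - 1) \<le> \<delta> / 2 * q ^ j" using assms by simp
    with S(4) have "S \<subseteq> cball 0 (\<delta> / 2 * q ^ j)"
      using subset_cball by blast
    then have "real (card S) \<le> (C * q ^ j) ^ card E"
      using S \<open>q \<ge> 1\<close> by (intro C[rule_format]) auto
    then have "real (card A) ^ j \<le> C ^ card E * (q ^ card E) ^ j"
      using S(2) by (simp add: power_mult_distrib power_mult[symmetric] mult.commute)
    then show ?thesis
      using \<open>q \<ge> 1\<close> by (simp add: power_divide field_simps)
  qed
  \<comment> \<open>The bound \<open>C ^ card E\<close> is the same for every \<open>j\<close>,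
    whereas the powers of a ratio above 1 are unbounded.\<close>
  have "real (card A) / q ^ card E \<le> 1"
  proof (rule ccontr)
    assume "\<not> ?thesis"
    then obtain j where "C ^ card E < (real (card A) / q ^ card E) ^ j"
      using real_arch_pow[of "real (card A) / q ^ card E"] by auto
    then show False using bound[of j] by simp
  qed
  then show ?thesis
    unfolding q_def[symmetric] using \<open>q \<ge> 1\<close> by (simp add: field_simps)
qed

text \<open>In a separated subset of largest cardinality no point can be added, so every point of
  \<open>S\<close> is within \<open>\<delta>\<close> of it. \<open>separated_card_le\<close> gives
  both the existence of a largest one and its size.\<close>

lemma finite_dim_cover:
  fixes E S :: "'a::real_normed_vector set"
  assumes "finite E" "S \<subseteq> span E" "S \<subseteq> cball 0 D" "\<delta> > 0" "D \<ge> 0"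
  shows "\<exists>C. finite C \<and> real (card C) \<le> (1 + 2 * D / \<delta>) ^ card E \<and> S \<subseteq> (\<Union>c\<in>C. cball c \<delta>)"
proof -
  define P where "P A \<longleftrightarrow> finite A \<and> A \<subseteq> S \<and> (\<forall>x\<in>A. \<forall>y\<in>A. x \<noteq> y \<longrightarrow> \<delta> \<le> dist x y)" for A
  have bound: "real (card A) \<le> (1 + 2 * D / \<delta>) ^ card E" if "P A" for A
    using that assms by (intro separated_card_le) (auto simp: P_def)
  then have "\<forall>A. P A \<longrightarrow> card A < Suc (nat \<lfloor>(1 + 2 * D / \<delta>) ^ card E\<rfloor>)"
    by (simp add: le_nat_floor less_Suc_eq_le)
  moreover have "P {}" by (simp add: P_def)
  ultimately have "\<exists>A. P A \<and> (\<forall>A'. P A' \<longrightarrow> card A' \<le> card A)"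
    by (intro ex_has_greatest_nat)
  then obtain A where A: "P A" "\<And>A'. P A' \<Longrightarrow> card A' \<le> card A"
    by blast
  have "\<exists>c\<in>A. x \<in> cball c \<delta>" if "x \<in> S" for x
  proof (rule ccontr)
    assume "\<not> ?thesis"
    then have far: "\<And>c. c \<in> A \<Longrightarrow> \<delta> < dist c x" by (auto simp: not_le)
    then have "x \<notin> A" using \<open>\<delta> > 0\<close> by force
    have "P (insert x A)"
      using A(1) far that by (auto simp: P_def dist_commute less_imp_le)
    then show False using A(2)[of "insert x A"] \<open>x \<notin> A\<close> A(1) by (simp add: P_def)
  qed
  then show ?thesis
    using A(1) bound by (intro exI[of _ A]) (auto simp: P_def)
qed

section \<open>Covering discs in the scalar field\<close>

lemma interval_grid:
  fixes s D :: real
  assumes "D > 0" "p > 0" "\<bar>s\<bar> \<le> D"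
  shows "\<exists>i<p. \<bar>s - D * (2 * real i + 1 - real p) / real p\<bar> \<le> D / real p"
proof -
  \<comment> \<open>\<open>w\<close> is the position of \<open>s\<close>, counted from
    \<open>- D\<close> in cells of width \<open>2 * D / p\<close>.\<close>
  define w where "w = (s + D) * real p / (2 * D)"
  have "0 \<le> w" using assms by (simp add: w_def)
  have "(s + D) * real p \<le> (2 * D) * real p"
    using assms by (intro mult_right_mono) auto
  then have "w \<le> real p" using assms by (simp add: w_def field_simps)
  have s: "s = D * (2 * w - p) / p"
    using assms by (simp add: w_def field_simps)
  obtain i where i: "i < p" "real i \<le> w" "w \<le> real i + 1"
  proof (cases "w = real p")
    \<comment> \<open>The right endpoint of the interval is assigned to the last cell.\<close>
    case True
    then show ?thesis using that[of "p - 1"] \<open>p > 0\<close> by (simp add: of_nat_diff)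
  next
    case False
    have "real (nat \<lfloor>w\<rfloor>) \<le> w" "w \<le> real (nat \<lfloor>w\<rfloor>) + 1"
      using \<open>0 \<le> w\<close> by linarith+
    then show ?thesis using that[of "nat \<lfloor>w\<rfloor>"] False \<open>w \<le> real p\<close> by linarith
  qed
  have "s - D * (2 * real i + 1 - real p) / real p = D / p * (2 * (w - i) - 1)"
    using assms by (simp add: s field_simps)
  moreover have "\<bar>2 * (w - i) - 1\<bar> \<le> 1" using i by simp
  then have "\<bar>D / p * (2 * (w - i) - 1)\<bar> \<le> D / p"
    using assms mult_left_le[of _ "D / p"] by (simp add: abs_mult del: times_divide_eq_left)
  ultimately show ?thesis using i(1) by auto
qed

lemma real_disc_cover:
  fixes D \<delta> :: real
  assumes "0 < \<delta>" "\<delta> \<le> D"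
  shows "\<exists>C::real set. finite C \<and> real (card C) \<le> 2 * D / \<delta> \<and> cball 0 D \<subseteq> (\<Union>c\<in>C. cball c \<delta>)"
proof -
  define p where "p = nat \<lfloor>2 * D / \<delta>\<rfloor>"
  have "2 * D / \<delta> \<ge> 2" using assms by (simp add: field_simps)
  \<comment> \<open>For \<open>x \<ge> 2\<close> the floor of \<open>x\<close> is at least
    \<open>x - 1 \<ge> x / 2\<close>; this keeps the half-width \<open>D / p\<close> below
    \<open>\<delta>\<close>.\<close>
  then have p: "p > 0" "real p \<le> 2 * D / \<delta>" "D / \<delta> \<le> real p"
    unfolding p_def by linarith+
  then have "D / p \<le> \<delta>" using assms by (simp add: field_simps)
  define C where "C = (\<lambda>i. D * (2 * real i + 1 - real p) / real p) ` {..<p}"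
  have "card C \<le> p" unfolding C_def using card_image_le[of "{..<p}"] by simp
  then have "real (card C) \<le> 2 * D / \<delta>" using p(2) by linarith
  moreover have "cball 0 D \<subseteq> (\<Union>c\<in>C. cball c \<delta>)"
  proof
    fix s :: real assume "s \<in> cball 0 D"
    then obtain i where "i < p" "\<bar>s - D * (2 * real i + 1 - real p) / real p\<bar> \<le> D / real p"
      using interval_grid[of D p s] p(1) assms by auto
    then show "s \<in> (\<Union>c\<in>C. cball c \<delta>)"
      using \<open>D / p \<le> \<delta>\<close> by (force simp: C_def dist_norm abs_minus_commute)
  qed
  ultimately show ?thesis by (intro exI[of _ C]) (simp add: C_def)
qed

text \<open>The square around the disc is cut into rectangles with half-sides \<open>D / p\<close>
  and \<open>D / q\<close>; the hypothesis \<open>pq\<close> says that their half-diagonal is at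
  most \<open>\<delta>\<close>.\<close>

lemma complex_disc_grid:
  fixes D \<delta> :: real
  assumes "0 < D" "0 < \<delta>" "p > 0" "q > 0" and pq: "(D / real p)\<^sup>2 + (D / real q)\<^sup>2 \<le> \<delta>\<^sup>2"
  shows "\<exists>C::complex set. finite C \<and> card C \<le> p * q \<and> cball 0 D \<subseteq> (\<Union>c\<in>C. cball c \<delta>)"
proof -
  define g where "g p i = D * (2 * real i + 1 - real p) / real p" for p i
  define C where "C = (\<lambda>(i, j). Complex (g p i) (g q j)) ` ({..<p} \<times> {..<q})"
  have "card C \<le> p * q"
    unfolding C_def using card_image_le[of "{..<p} \<times> {..<q}"] by simp
  moreover have "cball 0 D \<subseteq> (\<Union>c\<in>C. cball c \<delta>)"
  proof
    fix z :: complex assume "z \<in> cball 0 D"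
    then have "\<bar>Re z\<bar> \<le> D" "\<bar>Im z\<bar> \<le> D"
      using abs_Re_le_cmod[of z] abs_Im_le_cmod[of z] by auto
    then obtain i j where ij: "i < p" "j < q" "\<bar>Re z - g p i\<bar> \<le> D / p" "\<bar>Im z - g q j\<bar> \<le> D / q"
      using interval_grid[of D p "Re z"] interval_grid[of D q "Im z"] assms unfolding g_def by blast
    have "(Re z - g p i)\<^sup>2 \<le> (D / p)\<^sup>2" "(Im z - g q j)\<^sup>2 \<le> (D / q)\<^sup>2"
      using power_mono[OF ij(3), of 2] power_mono[OF ij(4), of 2] by simp_all
    then have "(cmod (z - Complex (g p i) (g q j)))\<^sup>2 \<le> \<delta>\<^sup>2"
      using pq by (simp add: cmod_power2)
    then have "cmod (z - Complex (g p i) (g q j)) \<le> \<delta>"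
      using \<open>0 < \<delta>\<close> power2_le_imp_le by simp
    then show "z \<in> (\<Union>c\<in>C. cball c \<delta>)"
      using ij(1,2) by (force simp: C_def dist_norm norm_minus_commute)
  qed
  ultimately show ?thesis by (intro exI[of _ C]) (simp add: C_def)
qed

text \<open>Separated sets would give \<open>(1 + 2 * D / \<delta>)\<^sup>2\<close>, too much for
  the case \<open>n = 1\<close>, hence the explicit grid. After scaling, the half-diagonal must be
  at most 1 with no more than \<open>4 * t\<^sup>2\<close> cells.\<close>

lemma complex_disc_cover:
  fixes D \<delta> :: real
  assumes "0 < \<delta>" "\<delta> \<le> D"
  shows "\<exists>C::complex set. finite C \<and> real (card C) \<le> (2 * D / \<delta>)\<^sup>2 \<and> cball 0 D \<subseteq> (\<Union>c\<in>C. cball c \<delta>)"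
proof -
  define t where "t = D / \<delta>"
  have "t \<ge> 1" and D: "D = t * \<delta>" using assms by (simp_all add: t_def)
  then have "t\<^sup>2 \<ge> 1" by simp
  have "\<exists>p q::nat. p > 0 \<and> q > 0 \<and> (t / p)\<^sup>2 + (t / q)\<^sup>2 \<le> 1 \<and> real p * real q \<le> 4 * t\<^sup>2"
  proof -
    \<comment> \<open>Square grids alone fail: for \<open>sqrt 2 < t < 3 / 2\<close> they need 9 > \<open>4 * t\<^sup>2\<close> cells, whereas 2 by 3 suffices.\<close>
    consider "t\<^sup>2 \<le> 2" | "2 < t\<^sup>2" "t \<le> 3/2" | "t > 3/2" by linarith
    then show ?thesis
    proof cases
      case 1
      then show ?thesis
        using \<open>t\<^sup>2 \<ge> 1\<close> by (intro exI[of _ 2]) (simp add: power_divide)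
    next
      case 2
      have "t\<^sup>2 \<le> (3/2)\<^sup>2" using 2 \<open>t \<ge> 1\<close> by (intro power_mono) auto
      then show ?thesis
        using 2 by (intro exI[of _ 2] exI[of _ 3]) (simp add: power_divide)
    next
      case 3
      \<comment> \<open>The finest square grid within the budget. Its diagonal condition
        \<open>2 * t\<^sup>2 \<le> m\<^sup>2\<close> follows from \<open>m \<ge> 3\<close> for
        \<open>t \<le> 2\<close>, and from \<open>m \<ge> 2 * t - 1\<close> beyond.\<close>
      define m where "m = nat \<lfloor>2 * t\<rfloor>"
      have m: "real m \<ge> 3" "real m \<le> 2 * t" "2 * t - 1 \<le> real m"
      proof -
        have "3 \<le> \<lfloor>2 * t\<rfloor>" using 3 by linarith
        then show "real m \<ge> 3" "real m \<le> 2 * t" "2 * t - 1 \<le> real m"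
          unfolding m_def by linarith+
      qed
      have "2 * t\<^sup>2 \<le> (real m)\<^sup>2"
      proof (cases "t \<le> 2")
        case True
        then have "t\<^sup>2 \<le> 2\<^sup>2" using 3 by (intro power_mono) auto
        moreover have "3\<^sup>2 \<le> (real m)\<^sup>2" using m by (intro power_mono) auto
        ultimately show ?thesis by simp
      next
        case False
        have "0 \<le> 2 * (t * (t - 2)) + 1" using False by simp
        then have "2 * t\<^sup>2 \<le> (2 * t - 1)\<^sup>2" by (simp add: power2_eq_square algebra_simps)
        also have "\<dots> \<le> (real m)\<^sup>2" using m False by (intro power_mono) auto
        finally show ?thesis .
      qed
      moreover have "real m * real m \<le> 2 * t * (2 * t)"
        using m by (intro mult_mono) auto
      ultimately show ?thesis
        using m by (intro exI[of _ m]) (simp add: power_divide field_simps power2_eq_square)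
    qed
  qed
  then obtain p q :: nat where pq: "p > 0" "q > 0" "(t / p)\<^sup>2 + (t / q)\<^sup>2 \<le> 1"
      "real p * real q \<le> 4 * t\<^sup>2"
    by blast
  have "(D / p)\<^sup>2 + (D / q)\<^sup>2 = \<delta>\<^sup>2 * ((t / p)\<^sup>2 + (t / q)\<^sup>2)"
    by (simp add: D power_mult_distrib power_divide algebra_simps)
  also have "\<dots> \<le> \<delta>\<^sup>2" using pq(3) by (simp add: mult_left_le)
  finally obtain C :: "complex set" where C: "finite C" "card C \<le> p * q" "cball 0 D \<subseteq> (\<Union>c\<in>C. cball c \<delta>)"
    using complex_disc_grid[of D \<delta> p q] assms pq by auto
  have "real (card C) \<le> real p * real q" using C(2) by (metis of_nat_le_iff of_nat_mult)
  also have "\<dots> \<le> (2 * D / \<delta>)\<^sup>2" using pq(4) by (simp add: t_def power_mult_distrib power_divide)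
  finally show ?thesis using C by blast
qed

section \<open>Covering numbers and approximation by finite-dimensional subspaces\<close>

text \<open>The order on \<open>enat\<close> is a well-order, and the empty set has infimum
  \<infinity>. This turns finite values of \<open>nu\<close> and \<open>covering_number\<close> into
  actual subspaces and covers.\<close>

lemma Inf_enat_mem:
  fixes N :: "enat set"
  assumes "Inf N \<noteq> \<infinity>"
  shows "Inf N \<in> N"
  using assms unfolding Inf_enat_def by (auto intro: LeastI_ex split: if_splits)

lemma covering_number_le_iff:
  "covering_number S \<epsilon> \<le> enat m \<longleftrightarrow> (\<exists>C. finite C \<and> card C \<le> m \<and> S \<subseteq> (\<Union>c\<in>C. ball c \<epsilon>))"
proof
  assume *: "covering_number S \<epsilon> \<le> enat m"
  then have "covering_number S \<epsilon> \<noteq> \<infinity>" by (cases "covering_number S \<epsilon>") auto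
  then have "covering_number S \<epsilon> \<in> {enat (card C) | C. finite C \<and> S \<subseteq> (\<Union>c\<in>C. ball c \<epsilon>)}"
    unfolding covering_number_def by (rule Inf_enat_mem)
  then show "\<exists>C. finite C \<and> card C \<le> m \<and> S \<subseteq> (\<Union>c\<in>C. ball c \<epsilon>)"
    using * by auto
next
  assume "\<exists>C. finite C \<and> card C \<le> m \<and> S \<subseteq> (\<Union>c\<in>C. ball c \<epsilon>)"
  then obtain C where C: "finite C" "card C \<le> m" "S \<subseteq> (\<Union>c\<in>C. ball c \<epsilon>)" by blast
  then have "covering_number S \<epsilon> \<le> enat (card C)"
    unfolding covering_number_def by (intro Inf_lower) auto
  then show "covering_number S \<epsilon> \<le> enat m"
    using C(2) by (meson enat_ord_simps(1) order_trans)
qed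

lemma hausdorff_semidist_leI:
  assumes "\<And>a. a \<in> A \<Longrightarrow> \<exists>b\<in>B. norm (a - b) \<le> r"
  shows "hausdorff_semidist A B \<le> ereal r"
  unfolding hausdorff_semidist_def
proof (rule SUP_least)
  fix a assume "a \<in> A"
  then obtain b where "b \<in> B" "norm (a - b) \<le> r" using assms by blast
  then show "(INF b\<in>B. ereal (norm (a - b))) \<le> ereal r" by (intro INF_lower2) auto
qed

lemma hausdorff_semidist_lessD:
  assumes "hausdorff_semidist A B < ereal r" "a \<in> A"
  shows "\<exists>b\<in>B. norm (a - b) < r"
proof -
  have "(INF b\<in>B. ereal (norm (a - b))) < ereal r"
    using SUP_lessD assms unfolding hausdorff_semidist_def by fast
  then show ?thesis by (auto simp: INF_less_iff)
qed

section \<open>Finiteness and semicontinuity of the approximation number\<close>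

context normed_space_over
begin

lemma nu_leI:
  assumes "subspace_of_dim sc n Z"
    "hausdorff_semidist (blinfun_apply T ` ball 0 1) (blinfun_apply T ` (ball 0 1 \<inter> Z)) < ereal r"
  shows "nu sc r T \<le> enat n"
  unfolding nu_def using assms by (intro Inf_lower) blast

lemma nu_attained:
  assumes "nu sc r T = enat n"
  obtains Z where "subspace_of_dim sc n Z"
    "hausdorff_semidist (blinfun_apply T ` ball 0 1) (blinfun_apply T ` (ball 0 1 \<inter> Z)) < ereal r"
proof -
  have "nu sc r T \<noteq> \<infinity>" using assms by simp
  then have "nu sc r T \<in> {enat n | n. \<exists>Z. subspace_of_dim sc n Z \<and>
    hausdorff_semidist (blinfun_apply T ` ball 0 1) (blinfun_apply T ` (ball 0 1 \<inter> Z)) < ereal r}"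
    unfolding nu_def by (rule Inf_enat_mem)
  then show ?thesis using that assms by auto
qed

lemma subspace_of_dim_0: "subspace_of_dim sc 0 Z \<longleftrightarrow> Z = {0}"
  unfolding subspace_of_dim_def using independent_empty by (auto intro: exI[of _ "{}"])

lemma subspace_of_dim_span:
  assumes "finite E"
  shows "\<exists>k. subspace_of_dim sc k (span E)"
proof -
  obtain B where B: "B \<subseteq> E" "independent B" "E \<subseteq> span B"
    using maximal_independent_subset[of E] by blast
  then have "span B = span E" by (metis span_eq span_superset subset_trans)
  then show ?thesis
    using B finite_subset[OF B(1) assms] unfolding subspace_of_dim_def
    by (intro exI[of _ "card B"]) (auto intro: exI[of _ B])
qed

text \<open>If \<open>norm T < r\<close>, the zero subspace already qualifies. In the final estimate
  this yields \<open>lam \<le> D\<close> for \<open>n > 0\<close>, so that the base of the power is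
  at least 1.\<close>

lemma norm_ge_of_nu_nonzero:
  assumes "nu sc r T \<noteq> 0"
  shows "r \<le> norm T"
proof (rule ccontr)
  assume "\<not> r \<le> norm T"
  have "hausdorff_semidist (blinfun_apply T ` ball 0 1) (blinfun_apply T ` (ball 0 1 \<inter> {0})) \<le> ereal (norm T)"
  proof (rule hausdorff_semidist_leI)
    fix a assume "a \<in> blinfun_apply T ` ball 0 1"
    then obtain x where "norm x < 1" "a = blinfun_apply T x" by auto
    then have "norm a \<le> norm T"
      using norm_blinfun[of T x] mult_left_le[of "norm x" "norm T"] by simp
    then show "\<exists>b\<in>blinfun_apply T ` (ball 0 1 \<inter> {0}). norm (a - b) \<le> norm T"
      by (intro bexI[of _ 0]) (auto simp: image_iff blinfun.zero_right)
  qed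
  also have "\<dots> < ereal r" using \<open>\<not> r \<le> norm T\<close> by simp
  finally have "nu sc r T \<le> enat 0"
    by (intro nu_leI[of 0 "{0}"]) (simp_all add: subspace_of_dim_0)
  then show False using assms by (simp add: zero_enat_def[symmetric])
qed

text \<open>Finitely many points \<open>X\<close> of the unit ball have \<open>C\<close>-images that
  approximate the whole image up to \<open>e\<close>, and their span serves as subspace. Replacing
  \<open>x\<close> by a point of \<open>X\<close> costs at most \<open>2 * norm L + e\<close>, as
  both lie in the unit ball; hence the bound \<open>r / 2\<close> on \<open>norm L\<close>.\<close>

lemma nu_finite:
  assumes "T \<in> near_compact_maps sc (r / 2)"
  shows "nu sc r T \<noteq> \<infinity>"
proof -
  obtain L C where LC: "C \<in> compact_maps sc" "T = L + C" "norm L < r / 2"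
    using assms by (auto simp: near_compact_maps_def)
  define e where "e = (r - 2 * norm L) / 2"
  have "e > 0" using LC by (simp add: e_def)
  have cpt: "compact (closure (blinfun_apply C ` ball 0 1))"
    using LC by (simp add: compact_maps_def)
  \<comment> \<open>Compactness is known only for the closure, but centres \<open>C x\<close> with
    \<open>x\<close> in the open ball still cover it, so the chosen points are admissible
    approximants.\<close>
  have sub: "closure (blinfun_apply C ` ball 0 1) \<subseteq> (\<Union>x\<in>ball 0 1. ball (blinfun_apply C x) e)"
  proof
    fix z assume "z \<in> closure (blinfun_apply C ` ball 0 1)"
    then obtain y where "y \<in> blinfun_apply C ` ball 0 1" "dist y z < e"
      using \<open>e > 0\<close> unfolding closure_approachable by blast
    then show "z \<in> (\<Union>x\<in>ball 0 1. ball (blinfun_apply C x) e)" by auto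
  qed
  obtain X where X: "X \<subseteq> ball 0 1" "finite X"
      "closure (blinfun_apply C ` ball 0 1) \<subseteq> (\<Union>x\<in>X. ball (blinfun_apply C x) e)"
    by (rule compactE_image[OF cpt _ sub]) auto
  have X_cover: "blinfun_apply C ` ball 0 1 \<subseteq> (\<Union>x\<in>X. ball (blinfun_apply C x) e)"
    by (rule subset_trans[OF closure_subset X(3)])
  obtain k where k: "subspace_of_dim sc k (span X)"
    using subspace_of_dim_span X(2) by blast
  have "hausdorff_semidist (blinfun_apply T ` ball 0 1) (blinfun_apply T ` (ball 0 1 \<inter> span X))
      \<le> ereal (2 * norm L + e)"
  proof (rule hausdorff_semidist_leI)
    fix a assume "a \<in> blinfun_apply T ` ball 0 1"
    then obtain x where x: "norm x < 1" "a = blinfun_apply T x" by auto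
    then obtain y where y: "y \<in> X" "dist (blinfun_apply C y) (blinfun_apply C x) < e"
      using X_cover by fastforce
    then have "norm y < 1" using X(1) by auto
    have "a - blinfun_apply T y = blinfun_apply L (x - y) - (blinfun_apply C y - blinfun_apply C x)"
      by (simp add: x LC blinfun.add_left blinfun.diff_right)
    then have "norm (a - blinfun_apply T y) \<le> norm (blinfun_apply L (x - y)) + dist (blinfun_apply C y) (blinfun_apply C x)"
      by (metis dist_norm norm_triangle_ineq4)
    also have "norm (blinfun_apply L (x - y)) \<le> norm L * norm (x - y)" by (rule norm_blinfun)
    also have "\<dots> \<le> norm L * 2"
      using norm_triangle_ineq4[of x y] x \<open>norm y < 1\<close> by (intro mult_left_mono) auto
    finally show "\<exists>b\<in>blinfun_apply T ` (ball 0 1 \<inter> span X). norm (a - b) \<le> 2 * norm L + e"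
      using y \<open>norm y < 1\<close> by (intro bexI[of _ "blinfun_apply T y"]) (auto intro: span_base)
  qed
  also have "\<dots> < ereal r" using \<open>e > 0\<close> by (simp add: e_def field_simps)
  finally have "nu sc r T \<le> enat k" using k by (rule nu_leI[rotated])
  then show ?thesis by (cases "nu sc r T") auto
qed

text \<open>The strict inequality in \<open>nu\<close> leaves room, so a subspace that is optimal
  for \<open>T\<close> also serves for nearby maps.\<close>

lemma nu_upper_semicontinuous:
  assumes "nu sc r T = enat k"
  shows "\<exists>\<eta>>0. \<forall>T'. norm (T' - T) < \<eta> \<longrightarrow> nu sc r T' \<le> enat k"
proof -
  obtain Z where Z: "subspace_of_dim sc k Z"
    and "hausdorff_semidist (blinfun_apply T ` ball 0 1) (blinfun_apply T ` (ball 0 1 \<inter> Z)) < ereal r"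
    using nu_attained assms by blast
  then obtain h where h: "hausdorff_semidist (blinfun_apply T ` ball 0 1) (blinfun_apply T ` (ball 0 1 \<inter> Z)) < ereal h"
      "h < r"
    using ereal_dense2 less_ereal.simps(1) by blast
  \<comment> \<open>Since \<open>norm (x - z) \<le> 2\<close>, a quarter of the gap suffices:
    \<open>h + 2 * ((r - h) / 4) = (h + r) / 2 < r\<close>.\<close>
  have "nu sc r T' \<le> enat k" if T': "norm (T' - T) < (r - h) / 4" for T'
  proof -
    have "hausdorff_semidist (blinfun_apply T' ` ball 0 1) (blinfun_apply T' ` (ball 0 1 \<inter> Z)) \<le> ereal ((h + r) / 2)"
    proof (rule hausdorff_semidist_leI)
      fix a assume "a \<in> blinfun_apply T' ` ball 0 1"
      then obtain x where x: "norm x < 1" "a = blinfun_apply T' x" by auto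
      then have "\<exists>b\<in>blinfun_apply T ` (ball 0 1 \<inter> Z). norm (blinfun_apply T x - b) < h"
        by (intro hausdorff_semidist_lessD[OF h(1)]) auto
      then obtain z where z: "norm z < 1" "z \<in> Z" "norm (blinfun_apply T x - blinfun_apply T z) < h"
        by auto
      have "a - blinfun_apply T' z = blinfun_apply (T' - T) (x - z) + (blinfun_apply T x - blinfun_apply T z)"
        by (simp add: x blinfun.diff_left blinfun.diff_right)
      then have "norm (a - blinfun_apply T' z) \<le> norm (blinfun_apply (T' - T) (x - z)) + norm (blinfun_apply T x - blinfun_apply T z)"
        by (metis norm_triangle_ineq)
      also have "norm (blinfun_apply (T' - T) (x - z)) \<le> norm (T' - T) * norm (x - z)" by (rule norm_blinfun)
      also have "\<dots> \<le> norm (T' - T) * 2"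
        using norm_triangle_ineq4[of x z] x z by (intro mult_left_mono) auto
      finally have "norm (a - blinfun_apply T' z) \<le> (h + r) / 2"
        using T' z by (simp add: field_simps)
      then show "\<exists>b\<in>blinfun_apply T' ` (ball 0 1 \<inter> Z). norm (a - b) \<le> (h + r) / 2"
        using z by (intro bexI[of _ "blinfun_apply T' z"]) auto
    qed
    also have "\<dots> < ereal r" using h by simp
    finally show ?thesis using Z by (rule nu_leI[rotated])
  qed
  then show ?thesis using h by (intro exI[of _ "(r - h) / 4"]) auto
qed

end

section \<open>Covering the image of the unit ball\<close>

lemma complex_span_subset_real_span:
  fixes csc :: "complex \<Rightarrow> 'a::real_normed_vector \<Rightarrow> 'a"
  assumes "normed_space_over csc" "finite E"
  shows "\<exists>F. finite F \<and> card F \<le> 2 * card E \<and> module.span csc E \<subseteq> real_vector.span F"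
proof -
  interpret normed_space_over csc by fact
  \<comment> \<open>Splitting a scalar into real and imaginary part writes \<open>csc c x\<close> as
    a real combination of \<open>x\<close> and \<open>csc \<i> x\<close>. This doubling is the
    source of the exponent factor 2 in the complex case.\<close>
  define F where "F = E \<union> csc \<i> ` E"
  have "card F \<le> 2 * card E"
    unfolding F_def using card_Un_le[of E "csc \<i> ` E"] card_image_le[OF \<open>finite E\<close>, of "csc \<i>"] by simp
  moreover have "x \<in> real_vector.span F" if x: "x \<in> module.span csc E" for x
    using x
  proof (induction rule: span_induct_alt)
    case base
    show ?case by (rule real_vector.span_zero)
  next
    case (step c x y)
    have "csc c x = Re c *\<^sub>R x + Im c *\<^sub>R csc \<i> x"
      by (subst complex_eq[of c])
        (simp add: scale_left_distrib scale_of_real mult.commute[of \<i>] flip: scale_scale)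
    moreover have "x \<in> F" "csc \<i> x \<in> F" using step by (auto simp: F_def)
    ultimately show ?case
      using step by (auto intro!: real_vector.span_add real_vector.span_scale intro: real_vector.span_base)
  qed
  ultimately show ?thesis
    using assms by (intro exI[of _ F]) (auto simp: F_def)
qed

text \<open>\<open>d\<close> stands for the real dimension of the scalar field; \<open>disc\<close>
  and \<open>real_span\<close> carry the dependence on that field. \<open>k\<close> belongs to one
  map, \<open>n\<close> will be the supremum over all of them. With
  \<open>t = D / \<delta> \<ge> 1\<close> one has
  \<open>1 + 2 * t \<le> 3 * t \<le> (n + 1) * t\<close> if \<open>n \<ge> 2\<close>; for
  \<open>n = 1\<close> a line is covered through a disc of scalars.\<close>

lemma finite_dim_image_cover:
  fixes sc :: "'k::real_normed_field \<Rightarrow> 'a::real_normed_vector \<Rightarrow> 'a"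
  assumes sc: "normed_space_over sc"
    and T: "T \<in> bounded_maps sc" "norm T \<le> D"
    and Z: "subspace_of_dim sc k Z" "k \<le> n"
    and \<delta>: "0 < \<delta>" "n > 0 \<Longrightarrow> \<delta> \<le> D"
    and disc: "\<And>R. \<delta> \<le> R \<Longrightarrow>
      \<exists>C::'k set. finite C \<and> real (card C) \<le> (2 * R / \<delta>) ^ d \<and> cball 0 R \<subseteq> (\<Union>c\<in>C. cball c \<delta>)"
    and real_span: "\<And>E. finite E \<Longrightarrow>
      \<exists>F. finite F \<and> card F \<le> d * card E \<and> module.span sc E \<subseteq> real_vector.span F"
  shows "\<exists>C. finite C \<and> real (card C) \<le> ((real n + 1) * D / \<delta>) ^ (d * n) \<and>
    blinfun_apply T ` (ball 0 1 \<inter> Z) \<subseteq> (\<Union>c\<in>C. cball c \<delta>)"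
proof -
  interpret normed_space_over sc by fact
  interpret T: Vector_Spaces.linear sc sc "blinfun_apply T"
    using T by (simp add: bounded_maps_def)
  let ?M = "(real n + 1) * D / \<delta>"
  have "D \<ge> 0" using T norm_ge_zero order_trans by blast
  have "?M \<ge> 1" if "n > 0"
  proof -
    have "1 * 1 \<le> (real n + 1) * (D / \<delta>)"
      using \<delta> that by (intro mult_mono) auto
    then show ?thesis by simp
  qed
  \<comment> \<open>In the degenerate cases a single ball stays within the bound; for
    \<open>n = 0\<close> the exponent vanishes, whatever \<open>D\<close> is.\<close>
  then have M: "1 \<le> ?M ^ (d * n)"
    by (cases "n = 0") (auto intro: one_le_power)
  obtain B where B: "finite B" "card B = k" "module.span sc B = Z"
    using Z by (auto simp: subspace_of_dim_def)
  have image_D: "norm (blinfun_apply T x) \<le> D" if "norm x < 1" for x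
  proof -
    have "norm (blinfun_apply T x) \<le> norm T * norm x" by (rule norm_blinfun)
    also have "\<dots> \<le> D * 1" using that T \<open>D \<ge> 0\<close> by (intro mult_mono) auto
    finally show ?thesis by simp
  qed
  consider "k = 0" | "k = 1" "n = 1" | "n \<ge> 2" using Z(2) by linarith
  then show ?thesis
  proof cases
    case 1
    then have "Z = {0}" using B by auto
    then show ?thesis
      using M \<delta>(1) by (intro exI[of _ "{0}"]) (auto simp: blinfun.zero_right)
  next
    case 2
    then obtain v where v: "B = {v}" using B card_1_singletonE by metis
    define w where "w = blinfun_apply T v"
    have Z_eq: "Z = range (\<lambda>c. sc c v)" using B v by (simp add: span_singleton)
    show ?thesis
    proof (cases "w = 0")
      case True
      then show ?thesis
        using M \<delta>(1) by (intro exI[of _ "{0}"]) (auto simp: Z_eq T.scale w_def[symmetric])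
    next
      case False
      \<comment> \<open>Since \<open>w'\<close> has norm 1, the map
        \<open>c \<mapsto> sc c w'\<close> is isometric and carries a cover of the scalar disc to
        the line.\<close>
      define w' where "w' = sc (of_real (inverse (norm w))) w"
      have "norm w' = 1" using False by (simp add: w'_def norm_scale norm_inverse)
      have w: "w = sc (of_real (norm w)) w'" using False by (simp add: w'_def flip: of_real_mult)
      obtain C :: "'k set" where C: "finite C" "real (card C) \<le> (2 * D / \<delta>) ^ d"
          "cball 0 D \<subseteq> (\<Union>c\<in>C. cball c \<delta>)"
        using disc[of D] \<delta>(2) 2 by auto
      show ?thesis
      proof (intro exI[of _ "(\<lambda>c. sc c w') ` C"] conjI)
        show "finite ((\<lambda>c. sc c w') ` C)" using C by simp
        have "real (card ((\<lambda>c. sc c w') ` C)) \<le> real (card C)"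
          using C(1) by (simp add: card_image_le)
        then show "real (card ((\<lambda>c. sc c w') ` C)) \<le> ?M ^ (d * n)"
          using C(2) 2 by simp
        show "blinfun_apply T ` (ball 0 1 \<inter> Z) \<subseteq> (\<Union>c\<in>(\<lambda>c. sc c w') ` C. cball c \<delta>)"
        proof
          fix y assume "y \<in> blinfun_apply T ` (ball 0 1 \<inter> Z)"
          then obtain c where c: "norm (sc c v) < 1" "y = blinfun_apply T (sc c v)"
            by (auto simp: Z_eq)
          define a where "a = c * of_real (norm w)"
          have y: "y = sc a w'"
            unfolding c(2) T.scale w_def[symmetric] a_def by (subst w) simp
          have "norm y \<le> D" using image_D c by simp
          then have "norm a \<le> D" by (simp add: y norm_scale \<open>norm w' = 1\<close>)
          then have "a \<in> cball 0 D" by simp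
          then obtain b where b: "b \<in> C" "norm (b - a) \<le> \<delta>"
            using C(3) by (auto simp: dist_norm)
          have "dist (sc b w') y = norm (b - a)"
            by (simp add: y dist_norm norm_scale \<open>norm w' = 1\<close> flip: scale_left_diff_distrib)
          then show "y \<in> (\<Union>c\<in>(\<lambda>c. sc c w') ` C. cball c \<delta>)" using b by (intro UN_I[of "sc b w'"]) auto
        qed
      qed
    qed
  next
    case 3
    then have D: "D / \<delta> \<ge> 1" using \<delta> by simp
    obtain F where F: "finite F" "card F \<le> d * card (blinfun_apply T ` B)"
        "module.span sc (blinfun_apply T ` B) \<subseteq> real_vector.span F"
      using real_span B(1) by (meson finite_imageI)
    have "blinfun_apply T ` (ball 0 1 \<inter> Z) \<subseteq> real_vector.span F"
      using F(3) B(3) T.span_image[of B] by auto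
    moreover have "blinfun_apply T ` (ball 0 1 \<inter> Z) \<subseteq> cball 0 D"
      using image_D by auto
    ultimately have "\<exists>C. finite C \<and> real (card C) \<le> (1 + 2 * D / \<delta>) ^ card F \<and>
        blinfun_apply T ` (ball 0 1 \<inter> Z) \<subseteq> (\<Union>c\<in>C. cball c \<delta>)"
      by (rule finite_dim_cover[OF F(1) _ _ \<delta>(1) \<open>D \<ge> 0\<close>])
    then obtain C where C: "finite C" "real (card C) \<le> (1 + 2 * D / \<delta>) ^ card F"
        "blinfun_apply T ` (ball 0 1 \<inter> Z) \<subseteq> (\<Union>c\<in>C. cball c \<delta>)"
      by (elim exE conjE)
    have "card F \<le> d * n"
      using F(2) card_image_le[OF B(1), of "blinfun_apply T"] B(2) Z(2)
      by (meson mult_le_mono2 order_trans)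
    have "3 * (D / \<delta>) \<le> (real n + 1) * (D / \<delta>)" using 3 D by (intro mult_right_mono) auto
    then have "1 + 2 * D / \<delta> \<le> ?M" using D by simp
    then have "(1 + 2 * D / \<delta>) ^ card F \<le> ?M ^ card F"
      using D by (intro power_mono) auto
    also have "\<dots> \<le> ?M ^ (d * n)"
      using \<open>card F \<le> d * n\<close> \<open>1 + 2 * D / \<delta> \<le> ?M\<close> D by (intro power_increasing) auto
    finally show ?thesis using C by (intro exI[of _ C]) auto
  qed
qed

text \<open>Approximation by the subspace is strict and the covering balls are closed, so the two
  distances add up to less than \<open>2 * \<delta>\<close>, as open balls require.\<close>

lemma covering_number_image_le:
  fixes sc :: "'k::real_normed_field \<Rightarrow> 'a::real_normed_vector \<Rightarrow> 'a"
  assumes sc: "normed_space_over sc"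
    and T: "T \<in> bounded_maps sc" "norm T \<le> D" "nu sc \<delta> T \<le> enat n"
    and \<delta>: "0 < \<delta>" "n > 0 \<Longrightarrow> \<delta> \<le> D"
    and disc: "\<And>R. \<delta> \<le> R \<Longrightarrow>
      \<exists>C::'k set. finite C \<and> real (card C) \<le> (2 * R / \<delta>) ^ d \<and> cball 0 R \<subseteq> (\<Union>c\<in>C. cball c \<delta>)"
    and real_span: "\<And>E. finite E \<Longrightarrow>
      \<exists>F. finite F \<and> card F \<le> d * card E \<and> module.span sc E \<subseteq> real_vector.span F"
  shows "ereal_of_enat (covering_number (blinfun_apply T ` ball 0 1) (2 * \<delta>))
    \<le> ereal (((real n + 1) * D / \<delta>) ^ (d * n))"
proof -
  obtain k where k: "nu sc \<delta> T = enat k" "k \<le> n"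
    using T(3) by (cases "nu sc \<delta> T") auto
  obtain Z where Z: "subspace_of_dim sc k Z"
    "hausdorff_semidist (blinfun_apply T ` ball 0 1) (blinfun_apply T ` (ball 0 1 \<inter> Z)) < ereal \<delta>"
    using normed_space_over.nu_attained[OF sc k(1)] by blast
  obtain C where C: "finite C" "real (card C) \<le> ((real n + 1) * D / \<delta>) ^ (d * n)"
      "blinfun_apply T ` (ball 0 1 \<inter> Z) \<subseteq> (\<Union>c\<in>C. cball c \<delta>)"
    using finite_dim_image_cover[OF sc T(1,2) Z(1) k(2) \<delta> disc real_span] by blast
  have "blinfun_apply T ` ball 0 1 \<subseteq> (\<Union>c\<in>C. ball c (2 * \<delta>))"
  proof
    fix a assume "a \<in> blinfun_apply T ` ball 0 1"
    then obtain b where b: "b \<in> blinfun_apply T ` (ball 0 1 \<inter> Z)" "norm (a - b) < \<delta>"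
      using hausdorff_semidist_lessD[OF Z(2)] by blast
    then obtain c where "c \<in> C" "dist c b \<le> \<delta>" using C(3) by fastforce
    moreover have "dist c a \<le> dist c b + dist a b" by (rule dist_triangle2)
    ultimately have "c \<in> C" "dist c a < 2 * \<delta>" using b(2) by (simp_all add: dist_norm)
    then show "a \<in> (\<Union>c\<in>C. ball c (2 * \<delta>))" by auto
  qed
  then have "covering_number (blinfun_apply T ` ball 0 1) (2 * \<delta>) \<le> enat (card C)"
    using C(1) by (subst covering_number_le_iff) blast
  then have "ereal_of_enat (covering_number (blinfun_apply T ` ball 0 1) (2 * \<delta>)) \<le> ereal (real (card C))"
    by (metis ereal_of_enat_le_iff ereal_of_enat_simps(1))
  also have "\<dots> \<le> ereal (((real n + 1) * D / \<delta>) ^ (d * n))" using C(2) by simp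
  finally show ?thesis .
qed

section \<open>Box dimension of sets covered by their image\<close>

text \<open>A Lebesgue number for the cover by open sets on which \<open>Df\<close> oscillates by at
  most \<open>\<eta>\<close>, combined with the mean value inequality along the segment from
  \<open>y\<close> to \<open>z\<close>. The derivative is taken at \<open>x\<close> in
  \<open>K\<close>, whereas the centre \<open>y\<close> may lie outside \<open>K\<close>.\<close>

lemma uniform_linearization:
  fixes f :: "'a::real_normed_vector \<Rightarrow> 'a" and Df :: "'a \<Rightarrow> 'a \<Rightarrow>\<^sub>L 'a"
  assumes "open U"
    and deriv: "\<And>x. x \<in> U \<Longrightarrow> (f has_derivative blinfun_apply (Df x)) (at x)"
    and "continuous_on U Df" "compact K" "K \<subseteq> U" "\<eta> > 0"
  shows "\<exists>r0>0. \<forall>x\<in>K. \<forall>r\<le>r0. \<forall>y z. x \<in> ball y r \<longrightarrow> z \<in> ball y r \<longrightarrow>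
    norm (f z - f y - blinfun_apply (Df x) (z - y)) \<le> \<eta> * r"
proof -
  define \<G> where "\<G> = {W. open W \<and> W \<subseteq> U \<and> (\<forall>v\<in>W. \<forall>w\<in>W. norm (Df v - Df w) \<le> \<eta>)}"
  have "K \<subseteq> \<Union>\<G>"
  proof
    fix x assume "x \<in> K"
    then have "x \<in> U" using assms by blast
    then have cont: "isCont Df x"
      using assms continuous_on_eq_continuous_at by blast
    have "\<eta> / 2 > 0" using \<open>\<eta> > 0\<close> by simp
    from cont[unfolded continuous_at_eps_delta, rule_format, OF this]
    obtain d where d: "d > 0" "\<forall>w. dist w x < d \<longrightarrow> dist (Df w) (Df x) < \<eta> / 2"
      by (elim exE conjE)
    obtain e where e: "e > 0" "ball x e \<subseteq> U"
      using \<open>open U\<close> \<open>x \<in> U\<close> openE by blast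
    have "norm (Df v - Df w) \<le> \<eta>" if "v \<in> ball x (min d e)" "w \<in> ball x (min d e)" for v w
    proof -
      have "norm (Df v - Df x) < \<eta> / 2" "norm (Df w - Df x) < \<eta> / 2"
        using that d(2) by (simp_all add: dist_norm norm_minus_commute)
      then show ?thesis using dist_triangle2[of "Df v" "Df w" "Df x"] by (simp add: dist_norm)
    qed
    then have "ball x (min d e) \<in> \<G>"
      using e by (auto simp: \<G>_def)
    then show "x \<in> \<Union>\<G>" using d e by (intro UnionI[of "ball x (min d e)"]) auto
  qed
  then obtain \<epsilon> where \<epsilon>: "\<epsilon> > 0" "\<And>x. x \<in> K \<Longrightarrow> \<exists>G\<in>\<G>. ball x \<epsilon> \<subseteq> G"
    by (rule Heine_Borel_lemma[OF \<open>compact K\<close>]) (auto simp: \<G>_def)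
  \<comment> \<open>With \<open>r \<le> \<epsilon> / 2\<close>, a ball of radius \<open>r\<close>
    containing \<open>x\<close> lies in \<open>ball x \<epsilon>\<close>, hence in one set of small
    oscillation inside \<open>U\<close>.\<close>
  have "norm (f z - f y - blinfun_apply (Df x) (z - y)) \<le> \<eta> * r"
    if "x \<in> K" "r \<le> \<epsilon> / 2" and xz: "x \<in> ball y r" "z \<in> ball y r" for x r y z
  proof -
    obtain W where W: "W \<in> \<G>" "ball x \<epsilon> \<subseteq> W" using \<epsilon>(2) \<open>x \<in> K\<close> by blast
    have "ball y r \<subseteq> ball x \<epsilon>"
    proof
      fix w assume "w \<in> ball y r"
      then show "w \<in> ball x \<epsilon>"
        using xz(1) dist_triangle3[of x w y] \<open>r \<le> \<epsilon> / 2\<close> by simp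
    qed
    then have sub: "ball y r \<subseteq> W" using W by blast
    have segment: "y + t *\<^sub>R (z - y) \<in> ball y r" if "t \<in> {0..1}" for t :: real
    proof -
      have "\<bar>t\<bar> * norm (z - y) \<le> 1 * norm (z - y)" using that by (intro mult_right_mono) auto
      then show ?thesis using xz(2) by (simp add: dist_norm norm_minus_commute)
    qed
    have deriv_W: "(f has_derivative blinfun_apply (Df w)) (at w within ball y r)" if "w \<in> ball y r" for w
    proof -
      have "w \<in> U" using that sub W(1) by (auto simp: \<G>_def)
      then show ?thesis by (rule deriv[THEN has_derivative_at_withinI])
    qed
    have close: "onorm (blinfun_apply (Df w) - blinfun_apply (Df x)) \<le> \<eta>" if "w \<in> ball y r" for w
    proof -
      have "w \<in> W" "x \<in> W" using that sub xz(1) by auto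
      then have "norm (Df w - Df x) \<le> \<eta>" using W(1) by (simp add: \<G>_def)
      then show ?thesis by (simp add: norm_blinfun.rep_eq minus_blinfun.rep_eq fun_diff_def)
    qed
    have "norm (f z - f y - blinfun_apply (Df x) (z - y)) \<le> norm (z - y) * \<eta>"
      by (rule differentiable_bound_linearization[OF segment deriv_W close xz(1)])
    also have "\<dots> \<le> r * \<eta>"
      using xz(2) \<open>\<eta> > 0\<close> by (intro mult_right_mono) (auto simp: dist_norm norm_minus_commute)
    finally show ?thesis by (simp add: mult.commute)
  qed
  then show ?thesis using \<epsilon>(1) by (intro exI[of _ "\<epsilon> / 2"]) auto
qed

text \<open>On a ball around \<open>y\<close> meeting \<open>K\<close>, the linear part is covered
  by \<open>m\<close> balls of radius \<open>\<mu> * r\<close>, and the linearization error is at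
  most \<open>(\<theta> - \<mu>) * r\<close>; the radii add up to
  \<open>\<theta> * r\<close>.\<close>

lemma covering_number_step:
  fixes f :: "'a::real_normed_vector \<Rightarrow> 'a" and Df :: "'a \<Rightarrow> 'a \<Rightarrow>\<^sub>L 'a"
  assumes "open U"
    and deriv: "\<And>x. x \<in> U \<Longrightarrow> (f has_derivative blinfun_apply (Df x)) (at x)"
    and "continuous_on U Df" "compact K" "K \<subseteq> U" "K \<subseteq> f ` K"
    and cover: "\<And>x. x \<in> K \<Longrightarrow> covering_number (blinfun_apply (Df x) ` ball 0 1) \<mu> \<le> enat m"
    and "\<mu> < \<theta>"
  shows "\<exists>r0>0. \<forall>r N. 0 < r \<longrightarrow> r \<le> r0 \<longrightarrow> covering_number K r \<le> enat N \<longrightarrow>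
    covering_number K (\<theta> * r) \<le> enat (N * m)"
proof -
  obtain r0 where "r0 > 0" and lin: "\<And>x r y z. x \<in> K \<Longrightarrow> r \<le> r0 \<Longrightarrow> x \<in> ball y r \<Longrightarrow> z \<in> ball y r \<Longrightarrow>
      norm (f z - f y - blinfun_apply (Df x) (z - y)) \<le> (\<theta> - \<mu>) * r"
    using uniform_linearization[OF assms(1-5), of "\<theta> - \<mu>"] \<open>\<mu> < \<theta>\<close> by auto
  have "covering_number K (\<theta> * r) \<le> enat (N * m)"
    if "0 < r" "r \<le> r0" and N: "covering_number K r \<le> enat N" for r N
  proof -
    obtain C where C: "finite C" "card C \<le> N" "K \<subseteq> (\<Union>c\<in>C. ball c r)"
      using N unfolding covering_number_le_iff by blast
    \<comment> \<open>Balls missing \<open>K\<close> are dropped: each remaining one must contain a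
      point of \<open>K\<close>, where \<open>cover\<close> applies.\<close>
    define C' where "C' = {y \<in> C. ball y r \<inter> K \<noteq> {}}"
    have "\<forall>y\<in>C'. \<exists>x. x \<in> K \<and> x \<in> ball y r" by (auto simp: C'_def)
    then obtain x where x: "\<And>y. y \<in> C' \<Longrightarrow> x y \<in> K \<and> x y \<in> ball y r" by metis
    have "\<forall>y\<in>C'. \<exists>E. finite E \<and> card E \<le> m \<and> blinfun_apply (Df (x y)) ` ball 0 1 \<subseteq> (\<Union>c\<in>E. ball c \<mu>)"
      using cover x unfolding covering_number_le_iff by blast
    then obtain E where E: "\<And>y. y \<in> C' \<Longrightarrow> finite (E y)" "\<And>y. y \<in> C' \<Longrightarrow> card (E y) \<le> m"
        "\<And>y. y \<in> C' \<Longrightarrow> blinfun_apply (Df (x y)) ` ball 0 1 \<subseteq> (\<Union>c\<in>E y. ball c \<mu>)"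
      by metis
    define S where "S = (\<Union>y\<in>C'. (\<lambda>c. f y + r *\<^sub>R c) ` E y)"
    have "finite C'" "card C' \<le> N"
      using C card_mono[of C C'] by (auto simp: C'_def)
    then have "finite S" using E by (simp add: S_def)
    have "card S \<le> (\<Sum>y\<in>C'. card ((\<lambda>c. f y + r *\<^sub>R c) ` E y))"
      unfolding S_def using \<open>finite C'\<close> by (rule card_UN_le)
    also have "\<dots> \<le> (\<Sum>y\<in>C'. m)"
      by (intro sum_mono) (meson E card_image_le order_trans)
    also have "\<dots> \<le> N * m" using \<open>card C' \<le> N\<close> by simp
    finally have "card S \<le> N * m" .
    moreover have "K \<subseteq> (\<Union>c\<in>S. ball c (\<theta> * r))"
    proof
      fix p assume "p \<in> K"
      then obtain z where z: "z \<in> K" "p = f z" using \<open>K \<subseteq> f ` K\<close> by blast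
      then obtain y where y: "y \<in> C" "z \<in> ball y r" using C(3) by blast
      then have "y \<in> C'" using z by (auto simp: C'_def)
      define h where "h = inverse r *\<^sub>R (z - y)"
      have "norm h < 1"
        using y(2) \<open>0 < r\<close> by (simp add: h_def dist_norm norm_minus_commute inverse_eq_divide)
      then have "blinfun_apply (Df (x y)) h \<in> blinfun_apply (Df (x y)) ` ball 0 1" by simp
      then obtain c where c: "c \<in> E y" "blinfun_apply (Df (x y)) h \<in> ball c \<mu>"
        using E(3)[OF \<open>y \<in> C'\<close>] by blast
      have "z - y = r *\<^sub>R h" using \<open>0 < r\<close> by (simp add: h_def)
      then have "p - (f y + r *\<^sub>R c) = (f z - f y - blinfun_apply (Df (x y)) (z - y))
          + r *\<^sub>R (blinfun_apply (Df (x y)) h - c)"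
        by (simp add: z blinfun.scaleR_right scaleR_diff_right)
      then have "norm (p - (f y + r *\<^sub>R c)) \<le> norm (f z - f y - blinfun_apply (Df (x y)) (z - y))
          + norm (r *\<^sub>R (blinfun_apply (Df (x y)) h - c))"
        by (metis norm_triangle_ineq)
      also have "norm (f z - f y - blinfun_apply (Df (x y)) (z - y)) \<le> (\<theta> - \<mu>) * r"
        using x[OF \<open>y \<in> C'\<close>] \<open>r \<le> r0\<close> y(2) by (intro lin) auto
      also have "norm (r *\<^sub>R (blinfun_apply (Df (x y)) h - c)) < r * \<mu>"
        using c(2) \<open>0 < r\<close> by (simp add: dist_norm norm_minus_commute)
      finally have "norm (p - (f y + r *\<^sub>R c)) < \<theta> * r" by (simp add: algebra_simps)
      then have "p \<in> ball (f y + r *\<^sub>R c) (\<theta> * r)" by (simp add: dist_norm norm_minus_commute)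
      moreover have "f y + r *\<^sub>R c \<in> S" using c(1) \<open>y \<in> C'\<close> by (auto simp: S_def)
      ultimately show "p \<in> (\<Union>c\<in>S. ball c (\<theta> * r))" by blast
    qed
    ultimately show ?thesis using \<open>finite S\<close> unfolding covering_number_le_iff by blast
  qed
  then show ?thesis using \<open>r0 > 0\<close> by blast
qed

section \<open>Box dimension from covers at geometric scales\<close>

lemma compact_covering_number:
  assumes "compact K" "r > 0"
  shows "\<exists>N. covering_number K r \<le> enat N"
proof -
  obtain C where "finite C" "K \<subseteq> (\<Union>c\<in>C. ball c r)"
    using seq_compact_imp_totally_bounded[OF compact_imp_seq_compact[OF assms(1)], rule_format, OF assms(2)]
    by (elim exE conjE)
  then have "covering_number K r \<le> enat (card C)"
    by (subst covering_number_le_iff) auto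
  then show ?thesis by blast
qed

lemma covering_number_antimono:
  assumes "r \<le> r'"
  shows "covering_number K r' \<le> covering_number K r"
proof (cases "covering_number K r")
  case (enat N)
  then have "covering_number K r \<le> enat N" by simp
  then obtain C where C: "finite C" "card C \<le> N" "K \<subseteq> (\<Union>c\<in>C. ball c r)"
    unfolding covering_number_le_iff by blast
  have "(\<Union>c\<in>C. ball c r) \<subseteq> (\<Union>c\<in>C. ball c r')"
    using subset_ball[OF assms] by (intro UN_mono) auto
  then have "K \<subseteq> (\<Union>c\<in>C. ball c r')" using C(3) by (rule subset_trans[rotated])
  then have "covering_number K r' \<le> enat N"
    unfolding covering_number_le_iff using C(1,2) by (intro exI[of _ C]) simp
  then show ?thesis using enat by simp
qed simp

text \<open>Passing from an arbitrary radius to the next smaller geometric scale costs at most one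
  factor \<open>M\<close>; such constants vanish after division by
  \<open>- ln \<epsilon>\<close>.\<close>

lemma upper_box_dim_leI:
  assumes "0 < \<theta>" "\<theta> < 1" "0 < r0" "1 \<le> M" "1 \<le> N0"
    and bound: "\<And>j. \<exists>N. covering_number K (\<theta> ^ j * r0) \<le> enat N \<and> real N \<le> N0 * M ^ j"
  shows "upper_box_dim K \<le> ereal (ln M / - ln \<theta>)"
proof -
  \<comment> \<open>\<open>A\<close> collects the terms of \<open>ln N0 + (w + 1) * ln M\<close>
    that do not depend on \<open>\<epsilon>\<close>.\<close>
  define A where "A = (1 - ln r0 / ln \<theta>) * ln M + ln N0"
  have "ln \<theta> < 0" using assms by simp
  have le: "(case covering_number K \<epsilon> of enat N \<Rightarrow> ereal (ln (real N) / - ln \<epsilon>) | \<infinity> \<Rightarrow> \<infinity>)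
      \<le> ereal (ln M / - ln \<theta> + A / - ln \<epsilon>)" if \<epsilon>: "0 < \<epsilon>" "\<epsilon> < min 1 r0" for \<epsilon>
  proof -
    \<comment> \<open>The real exponent at which the scale equals \<open>\<epsilon>\<close>; it is
      rounded up because \<open>\<theta> < 1\<close>.\<close>
    define w where "w = (ln \<epsilon> - ln r0) / ln \<theta>"
    have "ln \<epsilon> < ln r0" using \<epsilon> by simp
    then have "w > 0" using \<open>ln \<theta> < 0\<close> by (simp add: w_def divide_neg_neg)
    define j where "j = nat \<lceil>w\<rceil>"
    have j: "w \<le> real j" "real j \<le> w + 1" using \<open>w > 0\<close> unfolding j_def by linarith+
    have "real j * ln \<theta> \<le> w * ln \<theta>"
      using j(1) \<open>ln \<theta> < 0\<close> by (simp add: mult_right_mono_neg)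
    also have "\<dots> = ln \<epsilon> - ln r0" using \<open>ln \<theta> < 0\<close> by (simp add: w_def)
    finally have "ln (\<theta> ^ j * r0) \<le> ln \<epsilon>"
      using assms by (simp add: ln_mult ln_realpow)
    then have "\<theta> ^ j * r0 \<le> \<epsilon>"
      using assms \<epsilon> by (subst (asm) ln_le_cancel_iff) auto
    then have "covering_number K \<epsilon> \<le> covering_number K (\<theta> ^ j * r0)"
      by (rule covering_number_antimono)
    moreover obtain N where N: "covering_number K (\<theta> ^ j * r0) \<le> enat N" "real N \<le> N0 * M ^ j"
      using bound by blast
    ultimately have "covering_number K \<epsilon> \<le> enat N" by simp
    then obtain n where n: "covering_number K \<epsilon> = enat n" "n \<le> N"
      by (cases "covering_number K \<epsilon>") auto
    have "1 \<le> N0 * M ^ j" using assms mult_mono[of 1 N0 1 "M ^ j"] one_le_power[of M j] by simp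
    have "ln (real n) \<le> ln (N0 * M ^ j)"
    proof (cases "n = 0")
      \<comment> \<open>This is the case of empty \<open>K\<close>: \<open>ln 0 = 0\<close>, and the
        right-hand side is nonnegative.\<close>
      case True
      then show ?thesis using \<open>1 \<le> N0 * M ^ j\<close> by simp
    next
      case False
      then have "real n \<le> N0 * M ^ j" using n(2) N(2) by linarith
      then show ?thesis using False by simp
    qed
    also have "\<dots> = ln N0 + real j * ln M" using assms by (simp add: ln_mult ln_realpow)
    also have "\<dots> \<le> ln N0 + (w + 1) * ln M"
      using j(2) \<open>1 \<le> M\<close> by (intro add_left_mono mult_right_mono) auto
    also have "\<dots> = ln M / - ln \<theta> * - ln \<epsilon> + A"
      using \<open>ln \<theta> < 0\<close> by (simp add: A_def w_def field_simps)
    finally have "ln (real n) / - ln \<epsilon> \<le> (ln M / - ln \<theta> * - ln \<epsilon> + A) / - ln \<epsilon>"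
      using \<epsilon> by (intro divide_right_mono) auto
    also have "\<dots> = ln M / - ln \<theta> + A / - ln \<epsilon>"
      using \<epsilon> \<open>ln \<theta> < 0\<close> by (simp add: field_simps)
    finally show ?thesis by (simp add: n(1))
  qed
  have "((\<lambda>\<epsilon>::real. ln M / - ln \<theta> + A / - ln \<epsilon>) \<longlongrightarrow> ln M / - ln \<theta> + 0) (at_right 0)"
  proof (intro tendsto_add tendsto_const)
    have "filterlim (\<lambda>\<epsilon>::real. - ln \<epsilon>) at_top (at_right 0)"
      using ln_at_0 by (simp add: filterlim_uminus_at_top)
    then show "((\<lambda>\<epsilon>::real. A / - ln \<epsilon>) \<longlongrightarrow> 0) (at_right 0)"
      by (intro tendsto_divide_0[OF tendsto_const]) (rule filterlim_at_top_imp_at_infinity)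
  qed
  then have "((\<lambda>\<epsilon>::real. ereal (ln M / - ln \<theta> + A / - ln \<epsilon>)) \<longlongrightarrow> ereal (ln M / - ln \<theta>)) (at_right 0)"
    by (simp add: tendsto_ereal)
  then have "Limsup (at_right 0) (\<lambda>\<epsilon>::real. ereal (ln M / - ln \<theta> + A / - ln \<epsilon>)) = ereal (ln M / - ln \<theta>)"
    by (intro lim_imp_Limsup) auto
  moreover have "eventually (\<lambda>\<epsilon>. 0 < \<epsilon> \<and> \<epsilon> < min 1 r0) (at_right (0::real))"
    using eventually_at_right_real[of 0 "min 1 r0"] \<open>0 < r0\<close> by (auto elim: eventually_mono)
  then have "upper_box_dim K \<le> Limsup (at_right 0) (\<lambda>\<epsilon>::real. ereal (ln M / - ln \<theta> + A / - ln \<epsilon>))"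
    unfolding upper_box_dim_def by (intro Limsup_mono) (elim eventually_mono, intro le, auto)
  ultimately show ?thesis by simp
qed

text \<open>For each \<open>\<theta>\<close> in \<open>{\<mu><..<1}\<close> the one-step estimate is
  iterated from a finite cover at scale \<open>r0\<close>; the resulting bound passes to the limit
  as \<open>\<theta>\<close> decreases to \<open>\<mu>\<close>.\<close>

lemma upper_box_dim_le:
  fixes f :: "'a::real_normed_vector \<Rightarrow> 'a" and Df :: "'a \<Rightarrow> 'a \<Rightarrow>\<^sub>L 'a"
  assumes "open U"
    and deriv: "\<And>x. x \<in> U \<Longrightarrow> (f has_derivative blinfun_apply (Df x)) (at x)"
    and "continuous_on U Df" "compact K" "K \<subseteq> U" "K \<subseteq> f ` K"
    and cover: "\<And>x. x \<in> K \<Longrightarrow> ereal_of_enat (covering_number (blinfun_apply (Df x) ` ball 0 1) \<mu>) \<le> ereal M"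
    and "0 < \<mu>" "\<mu> < 1" "1 \<le> M"
  shows "upper_box_dim K \<le> ereal (ln M / - ln \<mu>)"
proof -
  define m where "m = nat \<lfloor>M\<rfloor>"
  have m: "real m \<le> M" using \<open>1 \<le> M\<close> by (simp add: m_def)
  have cover': "covering_number (blinfun_apply (Df x) ` ball 0 1) \<mu> \<le> enat m" if "x \<in> K" for x
    using cover[OF that] by (cases "covering_number (blinfun_apply (Df x) ` ball 0 1) \<mu>") (auto simp: m_def le_nat_floor)
  have bound: "upper_box_dim K \<le> ereal (ln M / - ln \<theta>)" if "\<mu> < \<theta>" "\<theta> < 1" for \<theta>
  proof -
    have "0 < \<theta>" using that \<open>0 < \<mu>\<close> by simp
    obtain r0 where "r0 > 0" and step: "\<And>r N. 0 < r \<Longrightarrow> r \<le> r0 \<Longrightarrow> covering_number K r \<le> enat N \<Longrightarrow>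
        covering_number K (\<theta> * r) \<le> enat (N * m)"
      using covering_number_step[OF assms(1-6) cover' \<open>\<mu> < \<theta>\<close>] by blast
    obtain N0 where N0: "covering_number K r0 \<le> enat N0"
      using compact_covering_number \<open>compact K\<close> \<open>r0 > 0\<close> by blast
    have iter: "covering_number K (\<theta> ^ j * r0) \<le> enat (N0 * m ^ j)" for j
    proof (induction j)
      case (Suc j)
      have "\<theta> ^ j * r0 \<le> r0"
        using \<open>0 < \<theta>\<close> \<open>\<theta> < 1\<close> \<open>r0 > 0\<close> by (simp add: mult_left_le_one_le power_le_one)
      then have "covering_number K (\<theta> * (\<theta> ^ j * r0)) \<le> enat (N0 * m ^ j * m)"
        using \<open>0 < \<theta>\<close> \<open>r0 > 0\<close> Suc by (intro step) auto
      then show ?case by (simp add: mult_ac)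
    qed (use N0 in simp)
    \<comment> \<open>Adding 1 keeps the constant at least 1 even when
      \<open>N0 = 0\<close>.\<close>
    have "real (N0 * m ^ j) \<le> (real N0 + 1) * M ^ j" for j
      using m power_mono[OF m, of j] by (simp add: mult_mono)
    then show ?thesis
      using iter \<open>0 < \<theta>\<close> \<open>\<theta> < 1\<close> \<open>r0 > 0\<close> \<open>1 \<le> M\<close>
      by (intro upper_box_dim_leI[of \<theta> r0 M "real N0 + 1"]) (auto simp del: of_nat_mult of_nat_power)
  qed
  have "((\<lambda>\<theta>. ereal (ln M / - ln \<theta>)) \<longlongrightarrow> ereal (ln M / - ln \<mu>)) (at_right \<mu>)"
    using \<open>0 < \<mu>\<close> \<open>\<mu> < 1\<close> by (intro tendsto_intros) auto
  moreover have "eventually (\<lambda>\<theta>. upper_box_dim K \<le> ereal (ln M / - ln \<theta>)) (at_right \<mu>)"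
    using eventually_at_right_real[OF \<open>\<mu> < 1\<close>] by (rule eventually_mono) (intro bound, auto)
  ultimately show ?thesis
    by (rule tendsto_lowerbound) simp
qed

text \<open>Semicontinuity gives each map a neighbourhood with a common bound, and finitely many of
  these suffice.\<close>

lemma nu_bounded_on_compact:
  assumes sc: "normed_space_over sc" and "compact \<T>"
    and near: "\<And>T. T \<in> \<T> \<Longrightarrow> T \<in> near_compact_maps sc (r / 2)"
  shows "\<exists>N. \<forall>T\<in>\<T>. nu sc r T \<le> enat N"
proof -
  interpret normed_space_over sc by fact
  have "\<forall>T\<in>\<T>. \<exists>k. nu sc r T = enat k"
    using nu_finite near by (meson not_infinity_eq)
  then obtain k where k: "\<And>T. T \<in> \<T> \<Longrightarrow> nu sc r T = enat (k T)" by metis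
  then have "\<forall>T\<in>\<T>. \<exists>\<eta>>0. \<forall>T'. norm (T' - T) < \<eta> \<longrightarrow> nu sc r T' \<le> enat (k T)"
    using nu_upper_semicontinuous by blast
  then obtain \<eta> where \<eta>: "\<And>T. T \<in> \<T> \<Longrightarrow> \<eta> T > 0"
      "\<And>T T'. T \<in> \<T> \<Longrightarrow> norm (T' - T) < \<eta> T \<Longrightarrow> nu sc r T' \<le> enat (k T)"
    by metis
  have sub: "\<T> \<subseteq> (\<Union>T\<in>\<T>. ball T (\<eta> T))" using \<eta>(1) by auto
  obtain F where F: "F \<subseteq> \<T>" "finite F" "\<T> \<subseteq> (\<Union>T\<in>F. ball T (\<eta> T))"
    by (rule compactE_image[OF \<open>compact \<T>\<close> _ sub]) auto
  \<comment> \<open>The sum stands in for the maximum and also makes sense for empty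
    \<open>F\<close>.\<close>
  have "nu sc r T \<le> enat (\<Sum>T\<in>F. k T)" if "T \<in> \<T>" for T
  proof -
    obtain T0 where T0: "T0 \<in> F" "T \<in> ball T0 (\<eta> T0)" using F(3) \<open>T \<in> \<T>\<close> by blast
    then have "nu sc r T \<le> enat (k T0)"
      using F(1) by (intro \<eta>(2)) (auto simp: dist_norm norm_minus_commute)
    also have "\<dots> \<le> enat (\<Sum>T\<in>F. k T)"
      using F(2) T0(1) by (simp add: member_le_sum)
    finally show ?thesis .
  qed
  then show ?thesis by blast
qed

section \<open>The covering bound and the dimension bound\<close>

text \<open>Treats both scalar fields at once: \<open>d = 1\<close> gives the real and
  \<open>d = 2\<close> the complex exponent.\<close>

lemma box_dim_bound_over_field:
  fixes f :: "'a::real_normed_vector \<Rightarrow> 'a" and Df :: "'a \<Rightarrow> 'a \<Rightarrow>\<^sub>L 'a"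
    and sc :: "'k::real_normed_field \<Rightarrow> 'a \<Rightarrow> 'a"
  assumes "open U"
    and deriv: "\<And>x. x \<in> U \<Longrightarrow> (f has_derivative blinfun_apply (Df x)) (at x)"
    and "continuous_on U Df" "compact K" "K \<subseteq> U" "K \<subseteq> f ` K"
    and lam: "0 < lam" "lam < 1 / 2"
    and sc: "normed_space_over sc"
    and near: "\<forall>x\<in>K. Df x \<in> near_compact_maps sc (lam / 2)"
    and disc: "\<And>R. lam \<le> R \<Longrightarrow>
      \<exists>C::'k set. finite C \<and> real (card C) \<le> (2 * R / lam) ^ d \<and> cball 0 R \<subseteq> (\<Union>c\<in>C. cball c lam)"
    and real_span: "\<And>E. finite E \<Longrightarrow>
      \<exists>F. finite F \<and> card F \<le> d * card E \<and> module.span sc E \<subseteq> real_vector.span F"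
  shows "bdd_above ((\<lambda>x. norm (Df x)) ` K) \<and>
    (\<exists>n::nat. enat n = (SUP x\<in>K. nu sc lam (Df x)) \<and>
      (let D = (SUP x\<in>K. norm (Df x)) in
        (\<forall>x\<in>K. ereal_of_enat (covering_number (blinfun_apply (Df x) ` ball 0 1) (2 * lam))
                 \<le> ereal (((real n + 1) * D / lam) ^ (d * n))) \<and>
        upper_box_dim K \<le> ereal (real (d * n) * (ln ((real n + 1) * D / lam) / - ln (2 * lam)))))"
proof -
  interpret normed_space_over sc by fact
  have "compact (Df ` K)"
    using assms by (meson compact_continuous_image continuous_on_subset)
  then have bdd: "bdd_above ((\<lambda>x. norm (Df x)) ` K)"
    by (intro bounded_imp_bdd_above) (simp add: bounded_norm_comp compact_imp_bounded)
  define D where "D = (SUP x\<in>K. norm (Df x))"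
  have D: "norm (Df x) \<le> D" if "x \<in> K" for x
    unfolding D_def using bdd that by (rule cSUP_upper[rotated])
  obtain N where "\<forall>T\<in>Df ` K. nu sc lam T \<le> enat N"
    using nu_bounded_on_compact[OF sc \<open>compact (Df ` K)\<close>] near by blast
  then have "(SUP x\<in>K. nu sc lam (Df x)) \<le> enat N" by (intro SUP_least) auto
  then obtain n where n: "(SUP x\<in>K. nu sc lam (Df x)) = enat n"
    by (cases "SUP x\<in>K. nu sc lam (Df x)") auto
  have nu_le: "nu sc lam (Df x) \<le> enat n" if "x \<in> K" for x
    unfolding n[symmetric] using that by (rule SUP_upper)
  have lam_le: "lam \<le> D" if "n > 0"
  proof -
    have "\<exists>x\<in>K. nu sc lam (Df x) \<noteq> 0"
    proof (rule ccontr)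
      assume "\<not> ?thesis"
      then have "(SUP x\<in>K. nu sc lam (Df x)) \<le> 0" by (intro SUP_least) auto
      then show False using n \<open>n > 0\<close> by (simp add: zero_enat_def)
    qed
    then obtain x where "x \<in> K" "lam \<le> norm (Df x)" using norm_ge_of_nu_nonzero by blast
    then show ?thesis using D by (meson order_trans)
  qed
  define b where "b = (real n + 1) * D / lam"
  have cover: "ereal_of_enat (covering_number (blinfun_apply (Df x) ` ball 0 1) (2 * lam)) \<le> ereal (b ^ (d * n))"
    if "x \<in> K" for x
  proof -
    have "Df x \<in> bounded_maps sc" using near that by (auto simp: near_compact_maps_def)
    then show ?thesis
      unfolding b_def
      by (rule covering_number_image_le[OF sc _ D[OF that] nu_le[OF that] lam(1) lam_le disc real_span])
  qed
  have b: "1 \<le> b" if "n > 0"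
  proof -
    have "1 * 1 \<le> (real n + 1) * (D / lam)"
      using lam lam_le that by (intro mult_mono) auto
    then show ?thesis by (simp add: b_def)
  qed
  \<comment> \<open>For \<open>n = 0\<close> the power is 1 whatever \<open>b\<close> is; this
    includes empty \<open>K\<close>, where \<open>D\<close> is the supremum of the empty
    set.\<close>
  have "1 \<le> b ^ (d * n)" by (cases "n = 0") (auto intro: one_le_power b)
  then have "upper_box_dim K \<le> ereal (ln (b ^ (d * n)) / - ln (2 * lam))"
    using lam by (intro upper_box_dim_le[OF assms(1-6) cover]) auto
  also have "ln (b ^ (d * n)) / - ln (2 * lam) = real (d * n) * (ln b / - ln (2 * lam))"
    using b by (cases "n = 0") (auto simp: ln_realpow)
  finally show ?thesis
    using bdd n cover by (auto simp: Let_def D_def[symmetric] b_def[symmetric])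
qed

theorem theorem2p5:
  fixes f :: "'a::banach \<Rightarrow> 'a"
    and Df :: "'a \<Rightarrow> 'a \<Rightarrow>\<^sub>L 'a"
    and U K :: "'a set"
    and lam :: real
    and csc :: "complex \<Rightarrow> 'a \<Rightarrow> 'a"
  assumes "open U"
    and "\<And>x. x \<in> U \<Longrightarrow> (f has_derivative blinfun_apply (Df x)) (at x)"
    and "continuous_on U Df"
    and "compact K" and "K \<subseteq> U" and "K \<subseteq> f ` K"
    and "0 < lam" and "lam < 1 / 2"
  shows
    \<comment> \<open>\<open>X\<close> a real Banach space\<close>
    "((\<forall>x\<in>K. Df x \<in> near_compact_maps scaleR (lam / 2)) \<longrightarrow>
        bdd_above ((\<lambda>x. norm (Df x)) ` K) \<and>
        (\<exists>n::nat. enat n = (SUP x\<in>K. nu scaleR lam (Df x)) \<and>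
          (let D = (SUP x\<in>K. norm (Df x)) in
            (\<forall>x\<in>K. ereal_of_enat (covering_number (blinfun_apply (Df x) ` ball 0 1) (2 * lam))
                     \<le> ereal (((real n + 1) * D / lam) ^ n)) \<and>
            upper_box_dim K \<le> ereal (real n * (ln ((real n + 1) * D / lam) / - ln (2 * lam))))))
     \<and>
     \<comment> \<open>\<open>X\<close> a complex Banach space, with scalar multiplication \<open>csc\<close>\<close>
     (normed_space_over csc \<and>
      (\<forall>x\<in>U. Vector_Spaces.linear csc csc (blinfun_apply (Df x))) \<and>
      (\<forall>x\<in>K. Df x \<in> near_compact_maps csc (lam / 2)) \<longrightarrow>
        bdd_above ((\<lambda>x. norm (Df x)) ` K) \<and>
        (\<exists>n::nat. enat n = (SUP x\<in>K. nu csc lam (Df x)) \<and>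
          (let D = (SUP x\<in>K. norm (Df x)) in
            (\<forall>x\<in>K. ereal_of_enat (covering_number (blinfun_apply (Df x) ` ball 0 1) (2 * lam))
                     \<le> ereal (((real n + 1) * D / lam) ^ (2 * n))) \<and>
            upper_box_dim K \<le> ereal (2 * real n * (ln ((real n + 1) * D / lam) / - ln (2 * lam))))))"
proof (intro conjI impI)
  assume near: "\<forall>x\<in>K. Df x \<in> near_compact_maps scaleR (lam / 2)"
  \<comment> \<open>Over the reals a set is its own real spanning set; the factor 1 matches
    \<open>d = 1\<close>.\<close>
  have "\<exists>F. finite F \<and> card F \<le> 1 * card E \<and> module.span scaleR E \<subseteq> span F"
    if "finite E" for E :: "'a set"
    using that by (intro exI[of _ E]) (simp add: span_raw_def)
  from box_dim_bound_over_field[OF assms normed_space_over_scaleR near _ this]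
  show "bdd_above ((\<lambda>x. norm (Df x)) ` K)"
    and "\<exists>n::nat. enat n = (SUP x\<in>K. nu scaleR lam (Df x)) \<and>
          (let D = (SUP x\<in>K. norm (Df x)) in
            (\<forall>x\<in>K. ereal_of_enat (covering_number (blinfun_apply (Df x) ` ball 0 1) (2 * lam))
                     \<le> ereal (((real n + 1) * D / lam) ^ n)) \<and>
            upper_box_dim K \<le> ereal (real n * (ln ((real n + 1) * D / lam) / - ln (2 * lam))))"
    using real_disc_cover[OF \<open>0 < lam\<close>] by simp_all
next
  assume csc: "normed_space_over csc \<and> (\<forall>x\<in>U. Vector_Spaces.linear csc csc (blinfun_apply (Df x))) \<and>
    (\<forall>x\<in>K. Df x \<in> near_compact_maps csc (lam / 2))"
  then have sc: "normed_space_over csc" and near: "\<forall>x\<in>K. Df x \<in> near_compact_maps csc (lam / 2)"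
    by blast+
  from box_dim_bound_over_field[OF assms sc near complex_disc_cover[OF \<open>0 < lam\<close>] complex_span_subset_real_span[OF sc]]
  show "bdd_above ((\<lambda>x. norm (Df x)) ` K)"
    and "\<exists>n::nat. enat n = (SUP x\<in>K. nu csc lam (Df x)) \<and>
          (let D = (SUP x\<in>K. norm (Df x)) in
            (\<forall>x\<in>K. ereal_of_enat (covering_number (blinfun_apply (Df x) ` ball 0 1) (2 * lam))
                     \<le> ereal (((real n + 1) * D / lam) ^ (2 * n))) \<and>
            upper_box_dim K \<le> ereal (2 * real n * (ln ((real n + 1) * D / lam) / - ln (2 * lam))))"
    by simp_all
qed

end
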